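(* Let $\mathfrak g=\mathfrak{sl}_3(\mathbb C)$. Then the Casimir algebra $\mathcal C_{\mathfrak g}$ is a proper subalgebra of $U\mathfrak g^{\mathfrak h}$, but $U\mathfrak g^{\mathfrak h}$ is generated as an algebra by $\mathcal C_{\mathfrak g}$ and the centre $Z(U\mathfrak g)$ of $U\mathfrak g$. In particular, $\mathcal C_{\mathfrak g}$ acts irreducibly on the (non-zero) weight spaces of any simple $\mathfrak g$-module.
   Context: For a complex semisimple Lie algebra $\mathfrak g$ with Cartan subalgebra $\mathfrak h$ and root system $R$, fix a nonzero multiple $\langle\cdot,\cdot\rangle$ of the Killing form, and for $\alpha\in R$ let $e_\alpha\in\mathfrak g_\alpha$, $f_\alpha\in\mathfrak g_{-\alpha}$ with $[e_\alpha,f_\alpha]=\alpha^\vee$ and $\kappa_\alpha=\frac{\langle\alpha,\alpha\rangle}{2}(e_\alpha f_\alpha+f_\alpha e_\alpha)\in U\mathfrak g$. The Casimir algebra $\mathcal C_{\mathfrak g}\subseteq U\mathfrak g$ is the subalgebra generated by all $\kappa_\alpha$, $\alpha\in R$, and by $\mathfrak h$. $U\mathfrak g^{\mathfrak h}$ is the subalgebra of elements of the enveloping algebra $U\mathfrak g$ commuting with $\mathfrak h$; it contains $\mathcal C_{\mathfrak g}$. *)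

theory Defs
  imports "HOL-Analysis.Analysis" "HOL-Library.Poly_Mapping"
begin

section \<open>Complex vector spaces, algebras and Lie algebras\<close>

class complex_vector = ab_group_add +
  fixes scaleC :: "complex \<Rightarrow> 'a \<Rightarrow> 'a"  (infixr \<open>*\<^sub>C\<close> 75)
  assumes scaleC_add_right: "c *\<^sub>C (x + y) = c *\<^sub>C x + c *\<^sub>C y"
    and scaleC_add_left: "(c + d) *\<^sub>C x = c *\<^sub>C x + d *\<^sub>C x"
    and scaleC_scaleC: "c *\<^sub>C (d *\<^sub>C x) = (c * d) *\<^sub>C x"
    and scaleC_one: "1 *\<^sub>C x = x"

global_interpretation cv: vector_space "scaleC :: complex \<Rightarrow> 'a \<Rightarrow> 'a :: complex_vector"
  by unfold_locales (simp_all add: scaleC_add_right scaleC_add_left scaleC_scaleC scaleC_one)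

abbreviation clinear :: "('a::complex_vector \<Rightarrow> 'b::complex_vector) \<Rightarrow> bool" where
  "clinear \<equiv> Vector_Spaces.linear scaleC scaleC"

lemma clinearI:
  assumes "\<And>x y. f (x + y) = f x + f y" and "\<And>c x. f (c *\<^sub>C x) = c *\<^sub>C f x"
  shows "clinear f"
  by unfold_locales (simp_all add: assms)

lemma clinear_add: "clinear f \<Longrightarrow> f (x + y) = f x + f y"
  by (rule module_hom.add[OF Vector_Spaces.linear.axioms(3)])

lemma clinear_scaleC: "clinear f \<Longrightarrow> f (c *\<^sub>C x) = c *\<^sub>C f x"
  by (rule module_hom.scale[OF Vector_Spaces.linear.axioms(3)])

class complex_algebra_1 = complex_vector + ring_1 +
  assumes mult_scaleC_left: "(c *\<^sub>C x) * y = c *\<^sub>C (x * y)"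
    and mult_scaleC_right: "x * (c *\<^sub>C y) = c *\<^sub>C (x * y)"

class complex_lie_algebra = complex_vector +
  fixes bracket :: "'a \<Rightarrow> 'a \<Rightarrow> 'a"
  assumes bracket_add_left: "bracket (x + y) z = bracket x z + bracket y z"
    and bracket_add_right: "bracket x (y + z) = bracket x y + bracket x z"
    and bracket_scaleC_left: "bracket (c *\<^sub>C x) y = c *\<^sub>C bracket x y"
    and bracket_scaleC_right: "bracket x (c *\<^sub>C y) = c *\<^sub>C bracket x y"
    and bracket_self: "bracket x x = 0"
    and jacobi: "bracket x (bracket y z) + bracket y (bracket z x) + bracket z (bracket x y) = 0"

definition subalgebra :: "'a::complex_algebra_1 set \<Rightarrow> bool" where
  "subalgebra A \<longleftrightarrow> cv.subspace A \<and> 1 \<in> A \<and> (\<forall>x\<in>A. \<forall>y\<in>A. x * y \<in> A)"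

definition centralizer :: "'a::monoid_mult set \<Rightarrow> 'a set" where
  "centralizer S = {u. \<forall>s\<in>S. u * s = s * u}"

abbreviation centre :: "'a::monoid_mult set" where
  "centre \<equiv> centralizer UNIV"


section \<open>Root data of a complex Lie algebra\<close>

text \<open>The trace does not depend on the chosen basis. It is meaningful in finite dimension only.\<close>

definition endo_trace :: "('a::complex_vector \<Rightarrow> 'a) \<Rightarrow> complex" where
  "endo_trace f =
     (let B = (SOME B. cv.independent B \<and> cv.span B = UNIV) in \<Sum>b\<in>B. cv.representation B (f b) b)"

definition killing_form :: "'a::complex_lie_algebra \<Rightarrow> 'a \<Rightarrow> complex" where
  "killing_form x y = endo_trace (\<lambda>z. bracket x (bracket y z))"

definition diagonalizable_endo :: "('a::complex_vector \<Rightarrow> 'a) \<Rightarrow> bool" where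
  "diagonalizable_endo f \<longleftrightarrow>
     (\<exists>B. cv.independent B \<and> cv.span B = UNIV \<and> (\<forall>b\<in>B. \<exists>c. f b = c *\<^sub>C b))"

definition abelian_subalgebra :: "'a::complex_lie_algebra set \<Rightarrow> bool" where
  "abelian_subalgebra H \<longleftrightarrow> cv.subspace H \<and> (\<forall>x\<in>H. \<forall>y\<in>H. bracket x y = 0)"

text \<open>The definition for semisimple Lie algebras: a maximal abelian subalgebra whose elements
  are ad-semisimple.\<close>

definition cartan_subalgebra :: "'a::complex_lie_algebra set \<Rightarrow> bool" where
  "cartan_subalgebra H \<longleftrightarrow>
     abelian_subalgebra H \<and>
     (\<forall>K. abelian_subalgebra K \<and> H \<subseteq> K \<longrightarrow> K = H) \<and>
     (\<forall>x\<in>H. diagonalizable_endo (bracket x))"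

text \<open>A functional on \<open>H\<close> is represented by its extension by zero outside of \<open>H\<close>, which makes
  the representation unique.\<close>

definition dual_space :: "'a::complex_vector set \<Rightarrow> ('a \<Rightarrow> complex) set" where
  "dual_space H = {\<alpha>. (\<forall>x\<in>H. \<forall>y\<in>H. \<alpha> (x + y) = \<alpha> x + \<alpha> y) \<and>
                     (\<forall>c. \<forall>x\<in>H. \<alpha> (c *\<^sub>C x) = c * \<alpha> x) \<and> (\<forall>x. x \<notin> H \<longrightarrow> \<alpha> x = 0)}"

definition root_space :: "'a::complex_lie_algebra set \<Rightarrow> ('a \<Rightarrow> complex) \<Rightarrow> 'a set" where
  "root_space H \<alpha> = {x. \<forall>t\<in>H. bracket t x = \<alpha> t *\<^sub>C x}"

definition roots :: "'a::complex_lie_algebra set \<Rightarrow> ('a \<Rightarrow> complex) set" where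
  "roots H = {\<alpha> \<in> dual_space H. \<alpha> \<noteq> (\<lambda>_. 0) \<and> root_space H \<alpha> \<noteq> {0}}"

text \<open>A bilinear form \<open>B\<close> that is nondegenerate on \<open>H\<close> identifies \<open>H\<close> with its dual; the form
  on the dual space is transported along this identification.\<close>

definition dual_vector ::
    "('a \<Rightarrow> 'a \<Rightarrow> complex) \<Rightarrow> 'a::complex_lie_algebra set \<Rightarrow> ('a \<Rightarrow> complex) \<Rightarrow> 'a" where
  "dual_vector B H \<alpha> = (THE t. t \<in> H \<and> (\<forall>x\<in>H. B t x = \<alpha> x))"

definition dual_form ::
    "('a \<Rightarrow> 'a \<Rightarrow> complex) \<Rightarrow> 'a::complex_lie_algebra set \<Rightarrow> ('a \<Rightarrow> complex) \<Rightarrow> ('a \<Rightarrow> complex) \<Rightarrow> complex" where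
  "dual_form B H \<alpha> \<beta> = B (dual_vector B H \<alpha>) (dual_vector B H \<beta>)"

definition coroot ::
    "('a \<Rightarrow> 'a \<Rightarrow> complex) \<Rightarrow> 'a::complex_lie_algebra set \<Rightarrow> ('a \<Rightarrow> complex) \<Rightarrow> 'a" where
  "coroot B H \<alpha> = (2 / dual_form B H \<alpha> \<alpha>) *\<^sub>C dual_vector B H \<alpha>"

definition root_vectors ::
    "('a \<Rightarrow> 'a \<Rightarrow> complex) \<Rightarrow> 'a::complex_lie_algebra set \<Rightarrow>
     (('a \<Rightarrow> complex) \<Rightarrow> 'a) \<Rightarrow> (('a \<Rightarrow> complex) \<Rightarrow> 'a) \<Rightarrow> bool" where
  "root_vectors B H e f \<longleftrightarrow>
     (\<forall>\<alpha>\<in>roots H. e \<alpha> \<in> root_space H \<alpha> \<and> f \<alpha> \<in> root_space H (\<lambda>t. - \<alpha> t) \<and>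
                  bracket (e \<alpha>) (f \<alpha>) = coroot B H \<alpha>)"


section \<open>The universal enveloping algebra\<close>

text \<open>Finitely supported functions on words form the free associative algebra on the
  set \<open>'a\<close>; the monoid of words has to be written additively for its convolution product.\<close>

datatype 'a word = Word (letters: "'a list")

instantiation word :: (type) monoid_add
begin
definition zero_word :: "'a word" where "0 = Word []"
definition plus_word :: "'a word \<Rightarrow> 'a word \<Rightarrow> 'a word" where
  "v + w = Word (letters v @ letters w)"
instance by standard (simp_all add: zero_word_def plus_word_def)
end

type_synonym 'a free_alg = "'a word \<Rightarrow>\<^sub>0 complex"

abbreviation (input) free_const :: "complex \<Rightarrow> 'a free_alg" where
  "free_const c \<equiv> Poly_Mapping.single 0 c"

definition free_gen :: "'a \<Rightarrow> 'a free_alg" where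
  "free_gen x = Poly_Mapping.single (Word [x]) 1"

text \<open>The first two families of relations turn the free algebra on the set \<open>'a\<close> into the
  tensor algebra of the vector space \<open>'a\<close>.\<close>

inductive_set uea_ideal :: "'a::complex_lie_algebra free_alg set" where
  rel_add: "free_gen (x + y) - (free_gen x + free_gen y) \<in> uea_ideal"
| rel_scaleC: "free_gen (c *\<^sub>C x) - free_const c * free_gen x \<in> uea_ideal"
| rel_bracket: "free_gen x * free_gen y - free_gen y * free_gen x - free_gen (bracket x y) \<in> uea_ideal"
| ideal_add: "p \<in> uea_ideal \<Longrightarrow> q \<in> uea_ideal \<Longrightarrow> p + q \<in> uea_ideal"
| ideal_mult: "p \<in> uea_ideal \<Longrightarrow> a * p * b \<in> uea_ideal"

lemma uea_ideal_left: "p \<in> uea_ideal \<Longrightarrow> a * p \<in> uea_ideal"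
  using uea_ideal.ideal_mult[of p a 1] by simp

lemma uea_ideal_right: "p \<in> uea_ideal \<Longrightarrow> p * b \<in> uea_ideal"
  using uea_ideal.ideal_mult[of p 1 b] by simp

lemma uea_ideal_zero: "0 \<in> uea_ideal"
  using uea_ideal_left[OF uea_ideal.rel_add, of 0] by simp

lemma uea_ideal_uminus: "p \<in> uea_ideal \<Longrightarrow> - p \<in> uea_ideal"
  using uea_ideal_left[of p "-1"] by simp

definition uea_rel :: "'a::complex_lie_algebra free_alg \<Rightarrow> 'a free_alg \<Rightarrow> bool" where
  "uea_rel p q \<longleftrightarrow> p - q \<in> uea_ideal"

lemma equivp_uea_rel: "equivp (uea_rel :: 'a::complex_lie_algebra free_alg \<Rightarrow> _)"
proof (rule equivpI)
  show "reflp (uea_rel :: 'a free_alg \<Rightarrow> _)" by (rule reflpI) (simp add: uea_rel_def uea_ideal_zero)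
  show "symp (uea_rel :: 'a free_alg \<Rightarrow> _)"
    by (rule sympI) (metis uea_rel_def uea_ideal_uminus minus_diff_eq)
  show "transp (uea_rel :: 'a free_alg \<Rightarrow> _)"
  proof (rule transpI)
    fix p q r :: "'a free_alg"
    assume "uea_rel p q" "uea_rel q r"
    then show "uea_rel p r"
      using uea_ideal.ideal_add[of "p - q" "q - r"] by (simp add: uea_rel_def)
  qed
qed

quotient_type (overloaded) 'a uea = "'a::complex_lie_algebra free_alg" / uea_rel
  by (rule equivp_uea_rel)

lemma uea_rel_refl: "uea_rel p p"
  by (simp add: uea_rel_def uea_ideal_zero)

lemma uea_rel_add: "uea_rel p p' \<Longrightarrow> uea_rel q q' \<Longrightarrow> uea_rel (p + q) (p' + q')"
  using uea_ideal.ideal_add[of "p - p'" "q - q'"] by (simp add: uea_rel_def algebra_simps)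

lemma uea_rel_uminus: "uea_rel p p' \<Longrightarrow> uea_rel (- p) (- p')"
  using uea_ideal_uminus[of "p - p'"] by (simp add: uea_rel_def)

lemma uea_rel_mult:
  assumes "uea_rel p p'" "uea_rel q q'"
  shows "uea_rel (p * q) (p' * q')"
proof -
  have "(p - p') * q + p' * (q - q') \<in> uea_ideal"
    using assms by (intro uea_ideal.ideal_add uea_ideal_left uea_ideal_right)
      (simp_all add: uea_rel_def)
  then show ?thesis by (simp add: uea_rel_def algebra_simps)
qed

lemma free_alg_induct [case_names zero single add]:
  fixes p :: "'a free_alg"
  assumes "P 0" and "\<And>w c. P (Poly_Mapping.single w c)" and "\<And>p q. P p \<Longrightarrow> P q \<Longrightarrow> P (p + q)"
  shows "P p"
proof -
  have "p = (\<Sum>w\<in>Poly_Mapping.keys p. Poly_Mapping.single w (Poly_Mapping.lookup p w))"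
    by (rule poly_mapping_eqI) (auto simp: lookup_sum lookup_single when_def in_keys_iff)
  moreover have "P (\<Sum>w\<in>A. Poly_Mapping.single w (Poly_Mapping.lookup p w))" if "finite A" for A
    using that by (induction A rule: finite_induct) (auto intro: assms)
  ultimately show ?thesis by (metis finite_keys)
qed

lemma free_const_commute: "p * free_const c = free_const c * p"
  by (induction p rule: free_alg_induct) (simp_all add: mult_single mult.commute algebra_simps)

lemma free_const_left_commute: "p * (free_const c * q) = free_const c * (p * q)"
  by (simp add: free_const_commute flip: mult.assoc)


section \<open>Lie algebra modules\<close>

definition lie_module :: "('a::complex_lie_algebra \<Rightarrow> 'v::complex_vector \<Rightarrow> 'v) \<Rightarrow> bool" where
  "lie_module \<rho> \<longleftrightarrow> (\<forall>x. clinear (\<rho> x)) \<and> (\<forall>v. clinear (\<lambda>x. \<rho> x v)) \<and>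
     (\<forall>x y v. \<rho> (bracket x y) v = \<rho> x (\<rho> y v) - \<rho> y (\<rho> x v))"

definition simple_lie_module :: "('a::complex_lie_algebra \<Rightarrow> 'v::complex_vector \<Rightarrow> 'v) \<Rightarrow> bool" where
  "simple_lie_module \<rho> \<longleftrightarrow> lie_module \<rho> \<and> (UNIV :: 'v set) \<noteq> {0} \<and>
     (\<forall>W. cv.subspace W \<and> (\<forall>x. \<forall>w\<in>W. \<rho> x w \<in> W) \<longrightarrow> W = {0} \<or> W = UNIV)"

definition weight_space ::
    "'a set \<Rightarrow> ('a::complex_lie_algebra \<Rightarrow> 'v::complex_vector \<Rightarrow> 'v) \<Rightarrow> ('a \<Rightarrow> complex) \<Rightarrow> 'v set" where
  "weight_space H \<rho> \<mu> = {v. \<forall>t\<in>H. \<rho> t v = \<mu> t *\<^sub>C v}"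

definition free_act :: "('a \<Rightarrow> 'v \<Rightarrow> 'v) \<Rightarrow> 'a free_alg \<Rightarrow> 'v \<Rightarrow> 'v::complex_vector" where
  "free_act \<rho> p v = (\<Sum>w\<in>Poly_Mapping.keys p. Poly_Mapping.lookup p w *\<^sub>C foldr \<rho> (letters w) v)"

lemma free_act_superset:
  assumes "finite A" "Poly_Mapping.keys p \<subseteq> A"
  shows "free_act \<rho> p v = (\<Sum>w\<in>A. Poly_Mapping.lookup p w *\<^sub>C foldr \<rho> (letters w) v)"
  unfolding free_act_def using assms
  by (intro sum.mono_neutral_left) (auto simp: in_keys_iff)

lemma free_act_zero: "free_act \<rho> 0 v = 0"
  by (simp add: free_act_def)

lemma free_act_single: "free_act \<rho> (Poly_Mapping.single w c) v = c *\<^sub>C foldr \<rho> (letters w) v"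
  by (subst free_act_superset[of "{w}"]) (auto simp: lookup_single)

lemma free_act_add: "free_act \<rho> (p + q) v = free_act \<rho> p v + free_act \<rho> q v"
proof -
  let ?A = "Poly_Mapping.keys p \<union> Poly_Mapping.keys q"
  have "Poly_Mapping.keys (p + q) \<subseteq> ?A" by (rule keys_add)
  then show ?thesis
    by (simp add: free_act_superset[of ?A] lookup_add scaleC_add_left sum.distrib)
qed

lemma free_act_diff: "free_act \<rho> (p - q) v = free_act \<rho> p v - free_act \<rho> q v"
  using free_act_add[of \<rho> "p - q" q v] by (simp add: algebra_simps)

lemma clinear_foldr:
  assumes "\<And>x. clinear (\<rho> x)"
  shows "clinear (foldr \<rho> xs)"
proof (rule clinearI)
  show "foldr \<rho> xs (u + v) = foldr \<rho> xs u + foldr \<rho> xs v" for u v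
    by (induction xs) (simp_all add: clinear_add[OF assms])
  show "foldr \<rho> xs (c *\<^sub>C v) = c *\<^sub>C foldr \<rho> xs v" for c v
    by (induction xs) (simp_all add: clinear_scaleC[OF assms])
qed

lemma clinear_free_act:
  assumes "\<And>x. clinear (\<rho> x)"
  shows "clinear (free_act \<rho> p)"
proof -
  note lin = clinear_foldr[of \<rho>, OF assms]
  show ?thesis
    by (rule clinearI)
      (simp_all add: free_act_def clinear_add[OF lin] clinear_scaleC[OF lin] scaleC_add_right
        sum.distrib cv.scale_sum_right scaleC_scaleC mult.commute)
qed

lemma free_act_mult:
  assumes "\<And>x. clinear (\<rho> x)"
  shows "free_act \<rho> (p * q) v = free_act \<rho> p (free_act \<rho> q v)"
proof (induction p rule: free_alg_induct)
  case zero
  show ?case by (simp add: free_act_zero)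
next
  case (add p p')
  then show ?case by (simp add: distrib_right free_act_add)
next
  case (single w c)
  note lin = clinear_foldr[of \<rho>, OF assms]
  show ?case
  proof (induction q rule: free_alg_induct)
    case zero
    show ?case using clinear_scaleC[OF clinear_free_act[of \<rho>, OF assms], of _ 0 0]
      by (simp add: free_act_zero)
  next
    case (add q q')
    then show ?case
      by (simp add: distrib_left free_act_add clinear_add[OF clinear_free_act[of \<rho>, OF assms]])
  next
    case (single w' c')
    show ?case
      by (simp add: mult_single free_act_single plus_word_def clinear_scaleC[OF lin] scaleC_scaleC)
  qed
qed

lemma free_act_gen: "free_act \<rho> (free_gen x) v = \<rho> x v"
  by (simp add: free_gen_def free_act_single scaleC_one)

lemma free_act_const: "free_act \<rho> (free_const c) v = c *\<^sub>C v"
  by (simp add: free_act_single zero_word_def)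

lemma free_act_ideal:
  assumes "lie_module \<rho>" "p \<in> uea_ideal"
  shows "free_act \<rho> p v = 0"
proof -
  have lin: "clinear (\<rho> x)" and lin': "clinear (\<lambda>x. \<rho> x v)"
    and br: "\<rho> (bracket x y) v = \<rho> x (\<rho> y v) - \<rho> y (\<rho> x v)" for x y v
    using assms(1) by (auto simp: lie_module_def)
  note simps = free_act_diff free_act_add free_act_gen free_act_const free_act_mult[of \<rho>, OF lin]
  show ?thesis using assms(2)
  proof (induction arbitrary: v)
    case (rel_add x y)
    show ?case by (simp add: simps clinear_add[OF lin'])
  next
    case (rel_scaleC c x)
    show ?case by (simp add: simps clinear_scaleC[OF lin'])
  next
    case (ideal_mult p a b)
    then show ?case
      using clinear_scaleC[OF clinear_free_act[of \<rho>, OF lin], of a 0 0] by (simp add: simps)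
  qed (simp_all add: simps br)
qed

instantiation complex :: complex_vector
begin
definition scaleC_complex :: "complex \<Rightarrow> complex \<Rightarrow> complex" where "scaleC_complex = (*)"
instance by standard (simp_all add: scaleC_complex_def algebra_simps)
end

lemma one_notin_uea_ideal: "1 \<notin> (uea_ideal :: 'a::complex_lie_algebra free_alg set)"
proof
  assume "1 \<in> (uea_ideal :: 'a free_alg set)"
  moreover have "lie_module (\<lambda>(_::'a) (_::complex). 0)"
    by (simp add: lie_module_def clinearI)
  ultimately have "free_act (\<lambda>(_::'a) (_::complex). 0) 1 1 = 0"
    by (rule free_act_ideal[rotated])
  then show False
    using free_act_const[of "\<lambda>(_::'a) (_::complex). 0" 1 1] by (simp add: scaleC_one)
qed


section \<open>The enveloping algebra as an algebra\<close>

instantiation uea :: (complex_lie_algebra) complex_algebra_1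
begin

lift_definition zero_uea :: "'a uea" is 0 .
lift_definition one_uea :: "'a uea" is 1 .
lift_definition plus_uea :: "'a uea \<Rightarrow> 'a uea \<Rightarrow> 'a uea" is "(+)" by (rule uea_rel_add)
lift_definition minus_uea :: "'a uea \<Rightarrow> 'a uea \<Rightarrow> 'a uea" is "(-)"
  by (metis diff_conv_add_uminus uea_rel_add uea_rel_uminus)
lift_definition uminus_uea :: "'a uea \<Rightarrow> 'a uea" is uminus by (rule uea_rel_uminus)
lift_definition times_uea :: "'a uea \<Rightarrow> 'a uea \<Rightarrow> 'a uea" is "(*)" by (rule uea_rel_mult)
lift_definition scaleC_uea :: "complex \<Rightarrow> 'a uea \<Rightarrow> 'a uea" is "\<lambda>c p. free_const c * p"
  by (rule uea_rel_mult[OF uea_rel_refl])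

instance
proof
  show "(0 :: 'a uea) \<noteq> 1"
    by transfer (metis uea_rel_def uea_ideal_uminus one_notin_uea_ideal diff_0 minus_minus)
  show "c *\<^sub>C (a + b) = c *\<^sub>C a + c *\<^sub>C b" for c and a b :: "'a uea"
    by transfer (simp add: distrib_left uea_rel_refl)
  show "(c + d) *\<^sub>C a = c *\<^sub>C a + d *\<^sub>C a" for c d and a :: "'a uea"
    by transfer (simp add: single_add distrib_right uea_rel_refl)
  show "c *\<^sub>C d *\<^sub>C a = (c * d) *\<^sub>C a" for c d and a :: "'a uea"
    by transfer (simp add: mult_single flip: mult.assoc, rule uea_rel_refl)
  show "1 *\<^sub>C a = a" for a :: "'a uea"
    by transfer (simp add: uea_rel_refl)
  show "c *\<^sub>C a * b = c *\<^sub>C (a * b)" for c and a b :: "'a uea"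
    by transfer (simp add: mult.assoc uea_rel_refl)
  show "a * c *\<^sub>C b = c *\<^sub>C (a * b)" for c and a b :: "'a uea"
    by transfer (simp add: free_const_left_commute uea_rel_refl)
qed (transfer, simp add: algebra_simps uea_rel_refl)+

end

lift_definition uea_of :: "'a::complex_lie_algebra \<Rightarrow> 'a uea" is free_gen .

text \<open>The action of the enveloping algebra on a module; by the lemmas below it is the unique
  unital algebra action extending that of the Lie algebra.\<close>

definition uea_act ::
    "('a::complex_lie_algebra \<Rightarrow> 'v::complex_vector \<Rightarrow> 'v) \<Rightarrow> 'a uea \<Rightarrow> 'v \<Rightarrow> 'v" where
  "uea_act \<rho> u v = free_act \<rho> (rep_uea u) v"

lemma uea_act_abs:
  assumes "lie_module \<rho>"
  shows "uea_act \<rho> (abs_uea p) v = free_act \<rho> p v"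
proof -
  have "uea_rel (rep_uea (abs_uea p)) p"
    using Quotient_uea by (metis Quotient_rep_abs uea_rel_refl)
  then have "free_act \<rho> (rep_uea (abs_uea p) - p) v = 0"
    using free_act_ideal[OF assms] by (simp add: uea_rel_def)
  then show ?thesis by (simp add: uea_act_def free_act_diff)
qed

lemma uea_of_add: "uea_of (x + y) = uea_of x + uea_of y"
  by transfer (simp add: uea_rel_def uea_ideal.rel_add)

lemma uea_of_scaleC: "uea_of (c *\<^sub>C x) = c *\<^sub>C uea_of x"
  by transfer (simp add: uea_rel_def uea_ideal.rel_scaleC)

lemma uea_of_bracket: "uea_of (bracket x y) = uea_of x * uea_of y - uea_of y * uea_of x"
proof -
  have "uea_of x * uea_of y - uea_of y * uea_of x = uea_of (bracket x y)"
    by transfer (simp add: uea_rel_def uea_ideal.rel_bracket)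
  then show ?thesis by simp
qed

lemma uea_act_of: "lie_module \<rho> \<Longrightarrow> uea_act \<rho> (uea_of x) v = \<rho> x v"
  by (simp add: uea_of.abs_eq uea_act_abs free_act_gen)

lemma uea_act_one: "lie_module \<rho> \<Longrightarrow> uea_act \<rho> 1 v = v"
  using free_act_const[of \<rho> 1 v] by (simp add: one_uea_def uea_act_abs scaleC_one)

lemma uea_act_add: "lie_module \<rho> \<Longrightarrow> uea_act \<rho> (a + b) v = uea_act \<rho> a v + uea_act \<rho> b v"
  by (induction a rule: uea.abs_induct, induction b rule: uea.abs_induct)
    (simp add: plus_uea.abs_eq uea_act_abs free_act_add)

lemma uea_act_mult: "lie_module \<rho> \<Longrightarrow> uea_act \<rho> (a * b) v = uea_act \<rho> a (uea_act \<rho> b v)"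
  by (induction a rule: uea.abs_induct, induction b rule: uea.abs_induct)
    (simp add: times_uea.abs_eq uea_act_abs free_act_mult lie_module_def)

lemma uea_act_scaleC: "lie_module \<rho> \<Longrightarrow> uea_act \<rho> (c *\<^sub>C a) v = c *\<^sub>C uea_act \<rho> a v"
  by (induction a rule: uea.abs_induct)
    (simp add: scaleC_uea.abs_eq uea_act_abs free_act_mult free_act_const lie_module_def)

lemma clinear_uea_act: "lie_module \<rho> \<Longrightarrow> clinear (uea_act \<rho> a)"
  unfolding uea_act_def[abs_def] by (intro clinear_free_act) (simp add: lie_module_def)

definition acts_irreducibly ::
    "('a::complex_lie_algebra \<Rightarrow> 'v::complex_vector \<Rightarrow> 'v) \<Rightarrow> 'a uea set \<Rightarrow> 'v set \<Rightarrow> bool" where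
  "acts_irreducibly \<rho> A V \<longleftrightarrow>
     cv.subspace V \<and> V \<noteq> {0} \<and> (\<forall>a\<in>A. \<forall>v\<in>V. uea_act \<rho> a v \<in> V) \<and>
     (\<forall>W. cv.subspace W \<and> W \<subseteq> V \<and> (\<forall>a\<in>A. \<forall>w\<in>W. uea_act \<rho> a w \<in> W) \<longrightarrow> W = {0} \<or> W = V)"


section \<open>The Casimir algebra\<close>

definition kappa ::
    "('a \<Rightarrow> 'a \<Rightarrow> complex) \<Rightarrow> 'a::complex_lie_algebra set \<Rightarrow>
     (('a \<Rightarrow> complex) \<Rightarrow> 'a) \<Rightarrow> (('a \<Rightarrow> complex) \<Rightarrow> 'a) \<Rightarrow> ('a \<Rightarrow> complex) \<Rightarrow> 'a uea" where
  "kappa B H e f \<alpha> =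
     (dual_form B H \<alpha> \<alpha> / 2) *\<^sub>C (uea_of (e \<alpha>) * uea_of (f \<alpha>) + uea_of (f \<alpha>) * uea_of (e \<alpha>))"

definition casimir_algebra ::
    "('a \<Rightarrow> 'a \<Rightarrow> complex) \<Rightarrow> 'a::complex_lie_algebra set \<Rightarrow>
     (('a \<Rightarrow> complex) \<Rightarrow> 'a) \<Rightarrow> (('a \<Rightarrow> complex) \<Rightarrow> 'a) \<Rightarrow> 'a uea set" where
  "casimir_algebra B H e f = subalgebra hull (kappa B H e f ` roots H \<union> uea_of ` H)"


section \<open>The special linear Lie algebra\<close>

typedef (overloaded) 'n sl = "{A :: complex^'n^'n::finite. trace A = 0}"
  by (rule exI[of _ 0]) (simp add: trace_def)

setup_lifting type_definition_sl

lemma matrix_add_rdist: "(A + B) ** C = A ** C + B ** (C :: complex^'n^'n)"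
  by (simp add: vec_eq_iff matrix_matrix_mult_def distrib_right sum.distrib)

lemma matrix_sub_dist:
  fixes A B C :: "complex^'n^'n"
  shows "(A - B) ** C = A ** C - B ** C" and "C ** (A - B) = C ** A - C ** B"
  by (simp_all add: vec_eq_iff matrix_matrix_mult_def left_diff_distrib right_diff_distrib sum_subtractf)

instantiation sl :: (finite) complex_lie_algebra
begin

lift_definition zero_sl :: "'a sl" is 0 by (simp add: trace_def)
lift_definition plus_sl :: "'a sl \<Rightarrow> 'a sl \<Rightarrow> 'a sl" is "(+)" by (simp add: trace_add)
lift_definition minus_sl :: "'a sl \<Rightarrow> 'a sl \<Rightarrow> 'a sl" is "(-)" by (simp add: trace_sub)
lift_definition uminus_sl :: "'a sl \<Rightarrow> 'a sl" is uminus by (simp add: trace_def sum_negf)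
lift_definition scaleC_sl :: "complex \<Rightarrow> 'a sl \<Rightarrow> 'a sl" is "\<lambda>c A. \<chi> i j. c * A $ i $ j"
proof -
  fix c :: complex and A :: "complex^'a^'a"
  assume "trace A = 0"
  then show "trace (\<chi> i j. c * A $ i $ j) = 0"
    by (simp add: trace_def sum_distrib_left[symmetric])
qed
lift_definition bracket_sl :: "'a sl \<Rightarrow> 'a sl \<Rightarrow> 'a sl" is "\<lambda>A B. A ** B - B ** A"
  by (metis trace_sub trace_mul_sym diff_self)

instance
proof
  fix x y z :: "'a sl" and c d :: complex
  show "x + y + z = x + (y + z)" by transfer (rule add.assoc)
  show "x + y = y + x" by transfer (rule add.commute)
  show "0 + x = x" by transfer (rule add_0)
  show "- x + x = 0" by transfer (rule left_minus)
  show "x - y = x + - y" by transfer (rule diff_conv_add_uminus)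
  show "c *\<^sub>C (x + y) = c *\<^sub>C x + c *\<^sub>C y" by transfer (simp add: vec_eq_iff distrib_left)
  show "(c + d) *\<^sub>C x = c *\<^sub>C x + d *\<^sub>C x" by transfer (simp add: vec_eq_iff distrib_right)
  show "c *\<^sub>C d *\<^sub>C x = (c * d) *\<^sub>C x" by transfer (simp add: mult.assoc)
  show "1 *\<^sub>C x = x" by transfer simp
  show "bracket (x + y) z = bracket x z + bracket y z"
    by transfer (simp add: matrix_add_ldistrib matrix_add_rdist)
  show "bracket x (y + z) = bracket x y + bracket x z"
    by transfer (simp add: matrix_add_ldistrib matrix_add_rdist)
  show "bracket (c *\<^sub>C x) y = c *\<^sub>C bracket x y"
    by transfer (simp add: vec_eq_iff matrix_matrix_mult_def sum_distrib_left right_diff_distrib mult_ac)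
  show "bracket x (c *\<^sub>C y) = c *\<^sub>C bracket x y"
    by transfer (simp add: vec_eq_iff matrix_matrix_mult_def sum_distrib_left right_diff_distrib mult_ac)
  show "bracket x x = 0" by transfer simp
  show "bracket x (bracket y z) + bracket y (bracket z x) + bracket z (bracket x y) = 0"
    by transfer (simp add: matrix_sub_dist matrix_mul_assoc)
qed

end

end

theory Submission
  imports Defs "HOL-Computational_Algebra.Fundamental_Theorem_Algebra"
    "HOL-Library.Function_Algebras"
begin

text \<open>
  A Cartan subalgebra of \<open>sl\<^sub>n\<close> consists of commuting ad-semisimple, hence diagonalizable, matrices,
  so after a change of basis it is the torus of traceless diagonal matrices
  (\<open>cartan_subalgebra_chart\<close>). The resulting isomorphism with the traceless matrices is called a chart
  below. In it the matrix units \<open>E i j\<close> span the root spaces, and the \<open>\<kappa>\<close> are non-zero multiples of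
  the elements \<open>E i j * E j i + E j i * E i j\<close> (\<open>kappa_root\<close>); everything else is a computation with
  the commutation rules of the matrix units.

  Generation. The enveloping algebra is spanned by words in the letters \<open>E i j\<close>, and a word is an
  eigenvector of the adjoint action of the torus. Hence \<open>U\<gg>\<^sup>\<hh>\<close> is spanned by
  the balanced words, those in which every index occurs as often as a row as it does as a column.
  Reading the letters as edges of a directed graph on three vertices, a balanced word is an Eulerian
  multigraph and so a union of cycles, of length at most three. Commuting two letters only costs
  shorter balanced words, so by induction on the length the cycles generate
  \<open>U\<gg>\<^sup>\<hh>\<close> (\<open>mon_balanced_in_subalgebra\<close>). Loops and two-cycles lie in the
  Casimir algebra. The commutator of two of its two-cycles is the difference of a three-cycle and its
  reverse, and rotating a three-cycle changes it by elements of the Casimir algebra. So modulo the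
  Casimir algebra there is only one three-cycle, and the cubic Casimir element
  \<open>\<Sum>i j k. E i j * E j k * E k i\<close>, which is central, is congruent to six times this one
  (\<open>tri_in_subalgebra\<close>).

  Properness. The zero weight spaces of the third symmetric power of \<open>\<complex>\<^sup>3\<close> and of its dual are lines
  on which the torus acts by zero and all \<open>\<kappa>\<close> act in the same way, so the Casimir algebra cannot
  tell them apart. A three-cycle acts by \<open>4\<close> on one and by \<open>-2\<close> on the other
  (\<open>tri_notin_casimir\<close>).

  Irreducibility. If \<open>v\<close> is a non-zero vector of a weight space of a simple module, then the words
  applied to \<open>v\<close> span the module, and comparing weights shows that the balanced words applied to \<open>v\<close>
  span the weight space. So \<open>U\<gg>\<^sup>\<hh>\<close> acts irreducibly on it. The centre acts by
  scalars, by Dixmier's version of Schur's lemma, which covers modules of infinite dimension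
  (\<open>centre_acts_by_scalars\<close>); hence the Casimir algebra alone is irreducible as well.
\<close>



section \<open>Operators on complex vector spaces\<close>

text \<open>The scalar multiplication is a parameter because the results are applied to \<open>\<complex>\<^sup>n\<close> with its
  multiplication \<open>(*s)\<close> as well as to the class of complex vector spaces.\<close>

locale complex_endomorphism = vector_space scale
  for scale :: "complex \<Rightarrow> 'b::ab_group_add \<Rightarrow> 'b" +
  fixes T :: "'b \<Rightarrow> 'b"
  assumes T_add: "T (x + y) = T x + T y"
    and T_scale: "T (scale c x) = scale c (T x)"
begin

lemma T_zero: "T 0 = 0"
  using T_scale[of 0 0] by simp

lemma T_sum: "T (sum g A) = (\<Sum>a\<in>A. T (g a))"
  by (induction A rule: infinite_finite_induct) (simp_all add: T_zero T_add)

definition peval :: "complex poly \<Rightarrow> 'b \<Rightarrow> 'b" where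
  "peval p v = (\<Sum>i\<le>degree p. scale (coeff p i) ((T ^^ i) v))"

lemma peval_bound:
  assumes "degree p \<le> n"
  shows "peval p v = (\<Sum>i\<le>n. scale (coeff p i) ((T ^^ i) v))"
  unfolding peval_def using assms
  by (intro sum.mono_neutral_left) (auto simp: coeff_eq_0 not_le)

lemma peval_0: "peval 0 v = 0"
  by (simp add: peval_def)

lemma peval_pCons: "peval (pCons a p) v = scale a v + T (peval p v)"
proof -
  have "peval (pCons a p) v = (\<Sum>i\<le>Suc (degree p). scale (coeff (pCons a p) i) ((T ^^ i) v))"
    by (rule peval_bound) (rule degree_pCons_le)
  also have "\<dots> = scale a v + T (peval p v)"
    by (simp add: sum.atMost_Suc_shift peval_def T_sum T_scale del: sum.atMost_Suc)
  finally show ?thesis .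
qed

lemma peval_add: "peval (p + q) v = peval p v + peval q v"
proof -
  let ?n = "max (degree p) (degree q)"
  have "degree (p + q) \<le> ?n" by (rule degree_add_le_max)
  then show ?thesis
    by (simp add: peval_bound[of _ ?n] scale_left_distrib sum.distrib)
qed

lemma peval_smult: "peval (smult a p) v = scale a (peval p v)"
  by (simp add: peval_bound[OF degree_smult_le] peval_def scale_sum_right)

lemma peval_sum: "peval (sum p A) v = (\<Sum>a\<in>A. peval (p a) v)"
  by (induction A rule: infinite_finite_induct) (simp_all add: peval_0 peval_add)

lemma T_pow_add: "(T ^^ i) (x + y) = (T ^^ i) x + (T ^^ i) y"
  by (induction i) (simp_all add: T_add)

lemma T_pow_scale: "(T ^^ i) (scale c x) = scale c ((T ^^ i) x)"
  by (induction i) (simp_all add: T_scale)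

lemma peval_add_vec: "peval p (x + y) = peval p x + peval p y"
  by (simp add: peval_def T_pow_add scale_right_distrib sum.distrib)

lemma peval_scale_vec: "peval p (scale c x) = scale c (peval p x)"
  by (simp add: peval_def T_pow_scale scale_sum_right scale_left_commute mult.commute)

lemma peval_zero_vec: "peval p 0 = 0"
  using peval_scale_vec[of p 0 0] by simp

lemma peval_sum_vec: "peval p (sum g A) = (\<Sum>a\<in>A. peval p (g a))"
  by (induction A rule: infinite_finite_induct) (simp_all add: peval_zero_vec peval_add_vec)

lemma peval_linear_factor: "peval ([:-c, 1:] * p) v = T (peval p v) - scale c (peval p v)"
proof -
  have "[:-c, 1:] * p = smult (- c) p + pCons 0 p" by simp
  then have "peval ([:-c, 1:] * p) v = peval (smult (- c) p) v + peval (pCons 0 p) v"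
    by (simp only: peval_add)
  then show ?thesis by (simp add: peval_smult peval_pCons del: smult_minus_left mult_pCons_left)
qed

lemma peval_linear_factor_vec: "peval ([:-c, 1:] * p) v = peval p (T v - scale c v)"
proof -
  have T_peval: "T (peval p v) = peval p (T v)"
    by (simp add: peval_def T_sum T_scale funpow_swap1)
  have "peval p (T v - scale c v) = peval p (T v) + scale (- c) (peval p v)"
    using peval_add_vec[of p "T v" "scale (- c) v"] by (simp add: peval_scale_vec del: scale_minus_left)
       (simp add: scale_minus_left)
  then show ?thesis by (simp add: peval_linear_factor T_peval del: mult_pCons_left)
qed

text \<open>Peel off one linear factor of \<open>q\<close> at a time: the last non-zero vector met on the way from \<open>v\<close> to
  \<open>q(T) v = 0\<close> is an eigenvector.\<close>

lemma eigenvector_if_annihilated: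
  assumes "subspace U" "\<And>u. u \<in> U \<Longrightarrow> T u \<in> U"
    and "q \<noteq> 0" "v \<in> U" "v \<noteq> 0" "peval q v = 0"
  shows "\<exists>c. \<exists>u\<in>U. u \<noteq> 0 \<and> T u = scale c u"
  using assms(3-6)
proof (induction "degree q" arbitrary: q)
  case 0
  then obtain a where "q = [:a:]" by (metis degree_eq_zeroE)
  then show ?case using 0 by (auto simp: peval_pCons peval_0 T_zero)
next
  case (Suc n)
  have "\<not> constant (poly q)"
    using Suc.hyps(2) by (simp add: constant_degree)
  then obtain c where "poly q c = 0"
    using fundamental_theorem_of_algebra by blast
  then obtain r where r: "q = [:-c, 1:] * r"
    by (metis poly_eq_0_iff_dvd dvdE)
  have "r \<noteq> 0" using r Suc.prems(1) by auto
  show ?case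
  proof (cases "peval r v = 0")
    case True
    have "degree q = Suc (degree r)"
      unfolding r using \<open>r \<noteq> 0\<close> by (subst degree_mult_eq) auto
    then show ?thesis using Suc True \<open>r \<noteq> 0\<close> by auto
  next
    case False
    have "(T ^^ i) v \<in> U" for i
      using assms(2) Suc.prems(2) by (induction i) auto
    then have "peval r v \<in> U"
      unfolding peval_def by (blast intro: subspace_sum[OF assms(1)] subspace_scale[OF assms(1)])
    moreover have "T (peval r v) = scale c (peval r v)"
      using Suc.prems(4) peval_linear_factor[of c r v] unfolding r by simp
    ultimately show ?thesis using False by blast
  qed
qed

lemma finite_subset_span:
  assumes "x \<in> span S"
  shows "\<exists>F. finite F \<and> F \<subseteq> S \<and> x \<in> span F"
proof -
  obtain F a where F: "finite F" "F \<subseteq> S" "x = (\<Sum>v\<in>F. scale (a v) v)"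
    using assms unfolding span_explicit by blast
  then have "x \<in> span F" by (simp add: span_sum span_scale span_base)
  then show ?thesis using F by blast
qed

text \<open>An independent set contains only finitely many vectors of the span of each initial segment of an
  enumeration of \<open>C\<close>.\<close>

lemma countable_independent:
  assumes "countable C" "independent S" "S \<subseteq> span C"
  shows "countable S"
proof (cases "C = {}")
  case True
  then show ?thesis using assms by (auto intro: countable_subset)
next
  case False
  define g where "g = from_nat_into C"
  have C: "C = range g" using False assms(1) by (simp add: g_def range_from_nat_into)
  have "S \<subseteq> (\<Union>n. S \<inter> span (g ` {..n}))"
  proof
    fix s assume "s \<in> S"
    then have "s \<in> span C" using assms(3) by blast
    then obtain F where F: "finite F" "F \<subseteq> C" "s \<in> span F"
      using finite_subset_span by blast
    obtain I where "finite I" "F = g ` I"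
      using F C by (meson finite_subset_image)
    then obtain n where "I \<subseteq> {..n}" by (meson finite_nat_iff_bounded_le)
    then have "s \<in> span (g ` {..n})"
      using span_mono[of F "g ` {..n}"] F(3) \<open>F = g ` I\<close> by blast
    then show "s \<in> (\<Union>n. S \<inter> span (g ` {..n}))" using \<open>s \<in> S\<close> by blast
  qed
  moreover have "finite (S \<inter> span (g ` {..n}))" for n
  proof -
    have "independent (S \<inter> span (g ` {..n}))"
      using assms(2) by (rule independent_mono) simp
    then show ?thesis
      using independent_span_bound[of "g ` {..n}" "S \<inter> span (g ` {..n})"] by simp
  qed
  then have "countable (\<Union>n. S \<inter> span (g ` {..n}))"
    by (intro countable_UN) (simp_all add: countable_finite)
  ultimately show ?thesis by (rule countable_subset)
qed

text \<open>Dixmier's argument. Without an eigenvector all \<open>T - c\<close> are bijective on \<open>U\<close>, so for a fixed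
  \<open>v \<noteq> 0\<close> there are vectors \<open>r c = (T - c)\<inverse> v\<close>, one for each complex number \<open>c\<close>. A non-trivial linear
  relation among them, multiplied by a common denominator, would give a non-zero polynomial in \<open>T\<close> that
  annihilates \<open>v\<close> and hence an eigenvector. But a space with a countable spanning set has no
  uncountable independent set. The hypothesis \<open>onto\<close> is what Schur's lemma gives for a central element
  acting on a simple module, and what counting dimensions gives for an operator in finite dimension.\<close>

lemma eigenvector_exists:
  assumes U: "subspace U" "U \<noteq> {0}" "\<And>u. u \<in> U \<Longrightarrow> T u \<in> U"
    and C: "countable C" "U \<subseteq> span C"
    and onto: "\<And>c. (\<forall>u\<in>U. T u = scale c u \<longrightarrow> u = 0) \<Longrightarrow> U \<subseteq> (\<lambda>u. T u - scale c u) ` U"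
  shows "\<exists>c. \<exists>u\<in>U. u \<noteq> 0 \<and> T u = scale c u"
proof (rule ccontr)
  assume no: "\<not> ?thesis"
  obtain v where v: "v \<in> U" "v \<noteq> 0"
    using U(1,2) subspace_0 by blast
  have "\<forall>c. \<exists>u. u \<in> U \<and> T u - scale c u = v"
  proof
    fix c
    have "U \<subseteq> (\<lambda>u. T u - scale c u) ` U" using no by (intro onto) blast
    then show "\<exists>u. u \<in> U \<and> T u - scale c u = v" using v(1) by auto
  qed
  then obtain r where r: "\<And>c. r c \<in> U" "\<And>c. T (r c) - scale c (r c) = v" by metis
  have inj: "inj r"
  proof
    fix c d assume "r c = r d"
    then have "scale c (r c) = scale d (r c)" using r(2)[of c] r(2)[of d] by (simp add: diff_eq_eq)
    moreover have "r c \<noteq> 0" using r(2)[of c] v(2) by (auto simp: T_zero)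
    ultimately show "c = d" by simp
  qed
  have "independent (range r)"
    unfolding independent_explicit_finite_subsets
  proof (intro allI impI ballI)
    fix S u s
    assume S: "S \<subseteq> range r" "finite S" "(\<Sum>v\<in>S. scale (u v) v) = 0" "s \<in> S"
    define F where "F = r -` S"
    have F: "finite F" "S = r ` F"
      using S inj by (auto simp: F_def finite_vimageI)
    \<comment> \<open>\<open>q c\<close> is the common denominator divided by its factor \<open>X - c\<close>.\<close>
    define q where "q c = (\<Prod>d\<in>F - {c}. [:-d, 1:])" for c
    define p where "p = (\<Sum>c\<in>F. smult (u (r c)) (q c))"
    have q: "(\<Prod>d\<in>F. [:-d, 1:]) = [:-c, 1:] * q c" if "c \<in> F" for c
      unfolding q_def using F(1) that by (rule prod.remove)
    have "peval p v = (\<Sum>c\<in>F. scale (u (r c)) (peval (\<Prod>d\<in>F. [:-d, 1:]) (r c)))"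
      unfolding p_def peval_sum
    proof (rule sum.cong[OF refl])
      fix c assume "c \<in> F"
      then show "peval (smult (u (r c)) (q c)) v =
          scale (u (r c)) (peval (\<Prod>d\<in>F. [:-d, 1:]) (r c))"
        by (simp only: q peval_linear_factor_vec r(2) peval_smult)
    qed
    also have "\<dots> = peval (\<Prod>d\<in>F. [:-d, 1:]) (\<Sum>c\<in>F. scale (u (r c)) (r c))"
      by (simp add: peval_sum_vec peval_scale_vec)
    also have "(\<Sum>c\<in>F. scale (u (r c)) (r c)) = 0"
      using S(3) F(2) inj by (simp add: sum.reindex inj_on_subset)
    finally have p0: "peval p v = 0" by (simp add: peval_zero_vec)
    have "p = 0"
      using eigenvector_if_annihilated[OF U(1,3) _ v p0] no by blast
    obtain c where c: "c \<in> F" "s = r c" using S(4) F(2) by blast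
    \<comment> \<open>Evaluating \<open>p\<close> at \<open>c\<close> singles out the coefficient of \<open>r c\<close>.\<close>
    have "0 = poly p c" by (simp add: \<open>p = 0\<close>)
    also have "\<dots> = (\<Sum>d\<in>F. u (r d) * (\<Prod>x\<in>F - {d}. c - x))"
      by (simp add: p_def q_def poly_sum poly_prod)
    also have "\<dots> = (\<Sum>d\<in>F. if d = c then u (r c) * (\<Prod>x\<in>F - {c}. c - x) else 0)"
      using F(1) c(1) by (intro sum.cong refl) (auto simp: prod_zero_iff)
    also have "\<dots> = u (r c) * (\<Prod>x\<in>F - {c}. c - x)"
      using F(1) c(1) by simp
    finally show "u s = 0" using F(1) c(2) by (auto simp: prod_zero_iff)
  qed
  then have "countable (range r)"
    using countable_independent[OF C(1)] C(2) r(1) by blast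
  then have "countable (UNIV :: complex set)"
    using inj by (simp add: countable_image_inj_eq)
  then show False using uncountable_UNIV_complex by blast
qed

text \<open>Weight arguments use this in place of the linear independence of eigenvectors: a combination of
  eigenvectors that \<open>T\<close> kills can be rewritten with those of eigenvalue zero. The family \<open>b\<close> is indexed
  because one vector may come from several indices, as for the words below.\<close>

lemma kernel_on_span_of_eigenvectors:
  assumes eig: "\<And>i. i \<in> I \<Longrightarrow> T (b i) = scale (\<mu> i) (b i)"
    and v: "v \<in> span (b ` I)" "T v = 0"
  shows "v \<in> span (b ` {i \<in> I. \<mu> i = 0})"
proof -
  define G where "G M = b ` {i \<in> I. \<mu> i \<in> insert 0 M}" for M
  have T_span: "T w \<in> span (G M)" if "w \<in> span (G M)" for w M
    using that
  proof (induction rule: span_induct_alt)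
    case base
    show ?case by (simp add: T_zero span_zero)
  next
    case (step c x y)
    then obtain i where "i \<in> I" "x = b i" by (auto simp: G_def)
    then have "T x = scale (\<mu> i) x" by (simp add: eig)
    then have Tx: "T x \<in> span (G M)" using step(1) by (simp add: span_scale span_base)
    show ?case using step Tx by (simp add: T_add T_scale span_add span_scale)
  qed
  have reduce: "w \<in> span (G {})" if "finite M" "w \<in> span (G M)" "T w = 0" for M w
    using that
  proof (induction M arbitrary: w rule: finite_induct)
    case (insert m M)
    show ?case
    proof (cases "m = 0")
      case True
      then show ?thesis using insert by (simp add: G_def)
    next
      case False
      define G' where "G' = b ` {i \<in> I. \<mu> i = m}"
      have "G (insert m M) = G M \<union> G'" by (auto simp: G_def G'_def)
      then obtain x y where xy: "w = x + y" "x \<in> span (G M)" "y \<in> span G'"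
        using insert.prems(1) by (auto simp: span_Un)
      have "T y = scale m y"
        using xy(3)
        by (induction rule: span_induct_alt)
          (auto simp: T_zero T_add T_scale G'_def eig scale_right_distrib scale_left_commute)
      \<comment> \<open>Apply \<open>m - T\<close> to \<open>w = x + y\<close>: this removes \<open>y\<close>, and it multiplies \<open>w\<close> by \<open>m\<close>.\<close>
      then have "scale m w = scale m x - T x"
        using insert.prems(2) by (simp add: xy(1) T_add scale_right_distrib algebra_simps)
      moreover have "scale m x - T x \<in> span (G M)"
        using xy(2) T_span by (intro span_diff span_scale)
      ultimately have "scale (inverse m) (scale m w) \<in> span (G M)"
        using span_scale by metis
      then have "w \<in> span (G M)" using False by simp
      then show ?thesis using insert by blast
    qed
  qed simp
  obtain F where F: "finite F" "F \<subseteq> b ` I" "v \<in> span F"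
    using v(1) finite_subset_span by blast
  then obtain J where J: "finite J" "J \<subseteq> I" "F = b ` J"
    by (meson finite_subset_image)
  have "F \<subseteq> G (\<mu> ` J)" using J by (auto simp: G_def)
  then have "v \<in> span (G (\<mu> ` J))" using F(3) span_mono by blast
  then have "v \<in> span (G {})" using reduce[of "\<mu> ` J"] J(1) v(2) by blast
  then show ?thesis by (simp add: G_def)
qed

end


section \<open>Simultaneous diagonalization\<close>

lemma complex_endomorphism_matrix:
  "complex_endomorphism (*s) ((*v) (A :: complex^'n^'n))"
  by unfold_locales (simp_all add: matrix_vector_right_distrib vector_scalar_commute)

text \<open>No generalized eigenvector of height two. Over the complex numbers this is diagonalizability, but it
  passes to invariant subspaces at once.\<close>

definition semisimple_matrix :: "complex^'n^'n \<Rightarrow> bool" where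
  "semisimple_matrix A \<longleftrightarrow>
     (\<forall>c v. A *v (A *v v - c *s v) = c *s (A *v v - c *s v) \<longrightarrow> A *v v = c *s v)"

lemma surj_on_subspace_if_inj:
  fixes A :: "complex^'n^'n"
  assumes U: "vec.subspace U" "\<And>u. u \<in> U \<Longrightarrow> A *v u \<in> U"
    and inj: "\<And>u. u \<in> U \<Longrightarrow> A *v u = 0 \<Longrightarrow> u = 0"
  shows "U \<subseteq> (\<lambda>u. A *v u) ` U"
proof -
  have lin: "Vector_Spaces.linear (*s) (*s) ((*v) A)" by simp
  have "inj_on ((*v) A) (vec.span U)"
    unfolding vec.span_eq_iff[THEN iffD2, OF U(1)]
  proof (rule inj_onI)
    fix x y assume "x \<in> U" "y \<in> U" "A *v x = A *v y"
    then show "x = y"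
      using inj[of "x - y"] vec.subspace_diff[OF U(1)] by (simp add: matrix_vector_mult_diff_distrib)
  qed
  then have "vec.dim ((*v) A ` U) = vec.dim U" by (rule vec.dim_image_eq[OF lin])
  then have "(*v) A ` U = U"
    using U by (intro vec.subspace_dim_equal) (auto simp: vec.subspace_image)
  then show ?thesis by simp
qed

lemma mat_vector_mult: "mat c *v v = c *s (v :: complex^'n)"
  by (simp add: vec_eq_iff matrix_vector_mult_def mat_def if_distrib if_distribR cong: if_cong)

lemma eigenvector_in_invariant_subspace:
  fixes A :: "complex^'n^'n"
  assumes U: "vec.subspace U" "\<And>u. u \<in> U \<Longrightarrow> A *v u \<in> U" "U \<noteq> {0}"
  shows "\<exists>c. \<exists>u\<in>U. u \<noteq> 0 \<and> A *v u = c *s u"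
proof -
  interpret complex_endomorphism "(*s)" "(*v) A" by (rule complex_endomorphism_matrix)
  show ?thesis
  proof (rule eigenvector_exists[OF U(1,3,2)])
    show "countable cart_basis" by (simp add: finite_cart_basis countable_finite)
    show "U \<subseteq> vec.span cart_basis" by simp
    fix c assume "\<forall>u\<in>U. A *v u = c *s u \<longrightarrow> u = 0"
    then have "U \<subseteq> (*v) (A - mat c) ` U"
      using U by (intro surj_on_subspace_if_inj)
        (auto simp: matrix_vector_mult_diff_rdistrib mat_vector_mult vec.subspace_diff vec.subspace_scale)
    then show "U \<subseteq> (\<lambda>u. A *v u - c *s u) ` U"
      by (simp add: matrix_vector_mult_diff_rdistrib mat_vector_mult)
  qed
qed

text \<open>If some \<open>A\<close> in \<open>S\<close> is not scalar on \<open>U\<close>, an eigenvalue \<open>c\<close> of \<open>A\<close> on \<open>U\<close> splits \<open>U\<close> into the kernel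
  \<open>K\<close> and the image \<open>I\<close> of \<open>A - c\<close>. Both are invariant under \<open>S\<close> and smaller than \<open>U\<close>; semisimplicity
  says that they meet in zero only, and then \<open>A - c\<close> is bijective on \<open>I\<close>, which gives \<open>U = K + I\<close>.\<close>

lemma joint_eigenvectors_span:
  fixes S :: "(complex^'n^'n) set"
  assumes comm: "\<And>A B. A \<in> S \<Longrightarrow> B \<in> S \<Longrightarrow> A ** B = B ** A"
    and ss: "\<And>A. A \<in> S \<Longrightarrow> semisimple_matrix A"
    and "vec.subspace U" "\<And>A u. A \<in> S \<Longrightarrow> u \<in> U \<Longrightarrow> A *v u \<in> U"
  shows "U \<subseteq> vec.span {u \<in> U. \<forall>A\<in>S. \<exists>c. A *v u = c *s u}"
  using assms(3,4)
proof (induction "vec.dim U" arbitrary: U rule: less_induct)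
  case less
  define J where "J V = {u \<in> V. \<forall>A\<in>S. \<exists>c. A *v u = c *s u}" for V
  show ?case
  proof (cases "U \<subseteq> J U")
    case True
    then show ?thesis unfolding J_def using vec.span_superset by blast
  next
    case False
    then obtain A u0 where A: "A \<in> S" and u0: "u0 \<in> U" "\<And>c. A *v u0 \<noteq> c *s u0"
      unfolding J_def by blast
    have "U \<noteq> {0}" using u0(1) u0(2)[of 0] by auto
    then obtain c u1 where u1: "u1 \<in> U" "u1 \<noteq> 0" "A *v u1 = c *s u1"
      using eigenvector_in_invariant_subspace[OF less.prems(1)] less.prems(2)[OF A] by blast
    define f where "f = A - mat c"
    have f: "f *v u = A *v u - c *s u" for u
      by (simp add: f_def matrix_vector_mult_diff_rdistrib mat_vector_mult)
    have fU: "f *v u \<in> U" if "u \<in> U" for u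
      unfolding f using less.prems A that
      by (intro vec.subspace_diff vec.subspace_scale) auto
    define K where "K = {u \<in> U. f *v u = 0}"
    define I where "I = (*v) f ` U"
    have K: "vec.subspace K"
      unfolding K_def using less.prems(1) 
      by (intro vec.subspaceI)
        (auto simp: vec.subspace_0 vec.subspace_add vec.subspace_scale matrix_vector_right_distrib vector_scalar_commute)
    have I: "vec.subspace I"
      unfolding I_def using less.prems(1) by (rule vec.subspace_image)
    have f_comm: "B *v (f *v u) = f *v (B *v u)" if "B \<in> S" for B u
    proof -
      have "B *v (A *v u) = A *v (B *v u)"
        using comm[OF A that] by (simp add: matrix_vector_mul_assoc)
      then show ?thesis by (simp add: f matrix_vector_mult_diff_distrib vector_scalar_commute)
    qed
    have KS: "B *v u \<in> K" if "B \<in> S" "u \<in> K" for B u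
      using that less.prems(2) f_comm[of B u] by (auto simp: K_def)
    have IS: "B *v u \<in> I" if "B \<in> S" "u \<in> I" for B u
      using that less.prems(2) f_comm by (auto simp: I_def)
    have "I \<subseteq> U" "K \<subseteq> U" using fU by (auto simp: I_def K_def)
    have KI: "u = 0" if "u \<in> K" "u \<in> I" for u
    proof -
      obtain v where v: "v \<in> U" "u = A *v v - c *s v" using \<open>u \<in> I\<close> f by (auto simp: I_def)
      have "A *v (A *v v - c *s v) = c *s (A *v v - c *s v)"
        using \<open>u \<in> K\<close> f[of u] v by (simp add: K_def)
      then have "A *v v = c *s v" using ss[OF A] unfolding semisimple_matrix_def by blast
      then show "u = 0" using v by simp
    qed
    have "u0 \<notin> K" using u0 by (auto simp: K_def f)
    then have "K \<subset> U" using \<open>K \<subseteq> U\<close> u0(1) by blast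
    then have dimK: "vec.dim K < vec.dim U"
      using K less.prems(1) by (intro vec.dim_psubset) (simp add: vec.span_eq_iff[THEN iffD2])
    have "u1 \<in> K" using u1 by (simp add: K_def f)
    then have "u1 \<notin> I" using KI u1(2) by blast
    then have "I \<subset> U" using \<open>I \<subseteq> U\<close> u1(1) by blast
    then have dimI: "vec.dim I < vec.dim U"
      using I less.prems(1) by (intro vec.dim_psubset) (simp add: vec.span_eq_iff[THEN iffD2])
    have "I \<subseteq> (*v) f ` I"
      using I
    proof (rule surj_on_subspace_if_inj)
      show "f *v u \<in> I" if "u \<in> I" for u using that \<open>I \<subseteq> U\<close> by (auto simp: I_def)
      show "u = 0" if "u \<in> I" "f *v u = 0" for u
        using KI[of u] that \<open>I \<subseteq> U\<close> by (auto simp: K_def)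
    qed
    have JK: "K \<subseteq> vec.span (J K)" and JI: "I \<subseteq> vec.span (J I)"
      unfolding J_def using less.hyps[OF dimK K KS] less.hyps[OF dimI I IS] by blast+
    have mono: "vec.span (J K) \<subseteq> vec.span (J U)" "vec.span (J I) \<subseteq> vec.span (J U)"
      using \<open>K \<subseteq> U\<close> \<open>I \<subseteq> U\<close> by (auto intro!: vec.span_mono simp: J_def)
    show ?thesis unfolding J_def[symmetric]
    proof
      fix u assume "u \<in> U"
      then have "f *v u \<in> I" by (simp add: I_def)
      then obtain w where w: "w \<in> I" "f *v u = f *v w" using \<open>I \<subseteq> (*v) f ` I\<close> by blast
      have "u - w \<in> K"
        using w \<open>u \<in> U\<close> \<open>I \<subseteq> U\<close> vec.subspace_diff[OF less.prems(1)]
        by (auto simp: K_def matrix_vector_mult_diff_distrib)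
      then have "(u - w) + w \<in> vec.span (J U)"
        using JK JI mono w(1) by (intro vec.span_add) blast+
      then show "u \<in> vec.span (J U)" by simp
    qed
  qed
qed

lemma simultaneous_diagonalization:
  fixes S :: "(complex^'n^'n) set"
  assumes comm: "\<And>A B. A \<in> S \<Longrightarrow> B \<in> S \<Longrightarrow> A ** B = B ** A"
    and ss: "\<And>A. A \<in> S \<Longrightarrow> semisimple_matrix A"
  obtains P Q :: "complex^'n^'n" where "P ** Q = mat 1" "Q ** P = mat 1"
    "\<And>A i j. A \<in> S \<Longrightarrow> i \<noteq> j \<Longrightarrow> (Q ** A ** P) $ i $ j = 0"
proof -
  define J where "J = {u. \<forall>A\<in>S. \<exists>c. A *v u = c *s u}"
  have "vec.span J = UNIV"
    using joint_eigenvectors_span[OF comm ss, of S UNIV] by (auto simp: J_def)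
  obtain B where B: "B \<subseteq> J" "vec.independent B" "J \<subseteq> vec.span B" "card B = vec.dim J"
    using vec.basis_exists by blast
  have spanB: "vec.span B = UNIV"
    using B(3) \<open>vec.span J = UNIV\<close> by (metis vec.span_mono vec.span_span top.extremum_uniqueI)
  have "finite B" using B(2) by (rule vec.finiteI_independent)
  moreover have "card B = CARD('n)"
    using B(2) spanB by (metis vec.dim_eq_card_independent vec.dim_span vec_dim_card)
  ultimately obtain b where b: "bij_betw b (UNIV :: 'n set) B"
    using finite_same_card_bij[of "UNIV :: 'n set" B] by auto
  define P :: "complex^'n^'n" where "P = (\<chi> i j. b j $ i)"
  have col: "column j P = b j" for j by (simp add: column_def P_def)
  have "columns P = B"
    using b by (auto simp: columns_def col bij_betw_def)
  then obtain Q where PQ: "P ** Q = mat 1"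
    using spanB matrix_right_invertible_span_columns[of P] by auto
  then have QP: "Q ** P = mat 1" using matrix_left_right_inverse by blast
  have "(Q ** A ** P) $ i $ j = 0" if A: "A \<in> S" and "i \<noteq> j" for A i j
  proof -
    have "b j \<in> J" using b B(1) by (auto simp: bij_betw_def)
    then obtain c where c: "A *v b j = c *s b j" using A by (auto simp: J_def)
    have "(Q ** A ** P) $ i $ j = (Q *v (A *v b j)) $ i"
      by (simp add: matrix_vector_mul_assoc) (simp add: matrix_matrix_mult_def matrix_vector_mult_def P_def)
    also have "\<dots> = c * (Q *v b j) $ i" by (simp add: c vector_scalar_commute)
    also have "(Q *v b j) $ i = (Q ** P) $ i $ j"
      by (simp add: matrix_matrix_mult_def matrix_vector_mult_def P_def)
    finally show ?thesis using \<open>i \<noteq> j\<close> by (simp add: QP mat_def)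
  qed
  then show ?thesis using that PQ QP by blast
qed


section \<open>Cartan subalgebras of traceless matrices\<close>

definition outer :: "complex^'n \<Rightarrow> complex^'n \<Rightarrow> complex^'n^'n" where
  "outer v \<phi> = (\<chi> i j. v $ i * \<phi> $ j)"

lemma matrix_mult_outer: "A ** outer v \<phi> = outer (A *v v) \<phi>"
  by (simp add: vec_eq_iff outer_def matrix_matrix_mult_def matrix_vector_mult_def sum_distrib_right mult.assoc)

lemma outer_mult_matrix: "outer v \<phi> ** A = outer v (\<phi> v* A)"
  by (simp add: vec_eq_iff outer_def matrix_matrix_mult_def vector_matrix_mult_def sum_distrib_left mult_ac)

lemma mat_commute: "mat c ** A = A ** mat (c :: complex)"
  by (simp add: vec_eq_iff matrix_matrix_mult_def mat_def if_distrib if_distribR mult.commute cong: if_cong)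

text \<open>Let \<open>w = (X - c) v \<noteq> 0\<close> be killed by \<open>X - c\<close>. Then \<open>X - c\<close> also kills some row vector \<open>\<phi> \<noteq> 0\<close> from
  the right. The rank one matrix \<open>v \<phi>\<close> satisfies \<open>[X, v \<phi>] = w \<phi> \<noteq> 0\<close> and \<open>[X, [X, v \<phi>]] = 0\<close>, which is
  impossible for a diagonalizable \<open>ad X\<close>. A multiple of the identity makes this matrix traceless without
  changing its commutators.\<close>

lemma semisimple_if_ad_diagonalizable:
  fixes x :: "'n::finite sl"
  assumes "diagonalizable_endo (bracket x)"
  shows "semisimple_matrix (Rep_sl x)"
  unfolding semisimple_matrix_def
proof (intro allI impI, rule ccontr)
  interpret ad: complex_endomorphism scaleC "\<lambda>y. bracket x (bracket x y)"
    by unfold_locales (simp_all add: bracket_add_right bracket_scaleC_right)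
  have ad_kernel: "bracket x y = 0" if "bracket x (bracket x y) = 0" for y
  proof -
    obtain B where B: "cv.span B = UNIV" "\<And>b. b \<in> B \<Longrightarrow> \<exists>c. bracket x b = c *\<^sub>C b"
      using assms by (auto simp: diagonalizable_endo_def)
    then obtain \<mu> where \<mu>: "\<And>b. b \<in> B \<Longrightarrow> bracket x b = \<mu> b *\<^sub>C b" by metis
    \<comment> \<open>Each eigenvector of \<open>ad x\<close> with a non-zero eigenvalue has a non-zero eigenvalue for the square.\<close>
    have "bracket x (bracket x b) = (\<mu> b * \<mu> b) *\<^sub>C b" if "b \<in> B" for b
      using that by (simp add: \<mu> bracket_scaleC_right)
    from ad.kernel_on_span_of_eigenvectors[of B "\<lambda>b. b" "\<lambda>b. \<mu> b * \<mu> b", OF this _ that]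
    have "y \<in> cv.span {b \<in> B. \<mu> b * \<mu> b = 0}" using B(1) by simp
    then show ?thesis
      by (induction rule: cv.span_induct_alt)
        (auto simp: \<mu> bracket_add_right bracket_scaleC_right bracket_scaleC_right[of x 0 0, simplified])
  qed
  fix c v
  define X where "X = Rep_sl x"
  define w where "w = X *v v - c *s v"
  assume "Rep_sl x *v (Rep_sl x *v v - c *s v) = c *s (Rep_sl x *v v - c *s v)"
    and "Rep_sl x *v v \<noteq> c *s v"
  then have w: "X *v w = c *s w" "w \<noteq> 0" by (simp_all add: X_def w_def)
  define N where "N = X - mat c"
  have "N *v w = 0" by (simp add: N_def matrix_vector_mult_diff_rdistrib mat_vector_mult w)
  then have "\<nexists>L. L ** N = mat 1" using w(2) matrix_left_invertible_ker[of N] by blast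
  then have "\<nexists>L. L ** transpose N = mat 1"
    by (simp add: left_invertible_transpose matrix_left_right_inverse)
  then obtain \<phi> where \<phi>: "transpose N *v \<phi> = 0" "\<phi> \<noteq> 0"
    using matrix_left_invertible_ker[of "transpose N"] by blast
  have \<phi>N: "\<phi> v* X = c *s \<phi>"
  proof -
    have "\<phi> v* mat c = c *s \<phi>"
      by (simp add: vec_eq_iff vector_matrix_mult_def mat_def if_distrib if_distribR mult.commute cong: if_cong)
    then show ?thesis using \<phi>(1) by (simp add: N_def vector_matrix_mult_diff_rdistrib)
  qed
  define t where "t = trace (outer v \<phi>) / of_nat CARD('n)"
  define Y where "Y = outer v \<phi> - mat t"
  have trY: "trace Y = 0"
    by (simp add: Y_def t_def trace_sub) (simp add: trace_def mat_def)
  define y where "y = Abs_sl Y"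
  have Rep_y: "Rep_sl y = Y" unfolding y_def using trY by (intro Abs_sl_inverse) simp
  have outer_scale: "outer (c *s a) b = outer a (c *s b)" "outer (a - a') b = outer a b - outer a' b" for a a' b
    by (simp_all add: vec_eq_iff outer_def algebra_simps)
  have "Rep_sl (bracket x y) = outer (X *v v) \<phi> - outer v (c *s \<phi>)"
    by (simp add: bracket_sl.rep_eq Rep_y X_def[symmetric] Y_def matrix_sub_dist matrix_mult_outer
        outer_mult_matrix \<phi>N mat_commute)
  then have Rep_xy: "Rep_sl (bracket x y) = outer w \<phi>"
    by (simp add: w_def outer_scale)
  have "Rep_sl (bracket x (bracket x y)) = outer (X *v w) \<phi> - outer w (c *s \<phi>)"
    by (simp add: bracket_sl.rep_eq[of x "bracket x y"] Rep_xy X_def[symmetric] matrix_mult_outer outer_mult_matrix \<phi>N)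
  then have "Rep_sl (bracket x (bracket x y)) = 0" by (simp add: w outer_scale)
  then have "bracket x (bracket x y) = 0" by (simp add: Rep_sl_inject[symmetric] zero_sl.rep_eq)
  then have "bracket x y = 0" by (rule ad_kernel)
  then have "outer w \<phi> = 0" using Rep_xy by (simp add: zero_sl.rep_eq)
  moreover obtain i j where "w $ i \<noteq> 0" "\<phi> $ j \<noteq> 0" using w(2) \<phi>(2) by (auto simp: vec_eq_iff)
  ultimately show False by (simp add: vec_eq_iff outer_def) (metis mult_eq_0_iff)
qed

text \<open>An isomorphism onto the traceless matrices. For a Cartan subalgebra \<open>H\<close> it is the conjugation into a
  basis of joint eigenvectors of \<open>H\<close>.\<close>

locale sl_chart =
  fixes M :: "'a::complex_lie_algebra \<Rightarrow> complex^'n^'n"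
  assumes M_add: "M (x + y) = M x + M y"
    and M_scale: "M (c *\<^sub>C x) $ i $ j = c * M x $ i $ j"
    and M_bracket: "M (bracket x y) = M x ** M y - M y ** M x"
    and M_inject: "M x = M y \<Longrightarrow> x = y"
    and M_range: "(\<exists>x. M x = A) \<longleftrightarrow> trace A = 0"

text \<open>Joint diagonalization puts \<open>H\<close> inside the diagonal matrices of a suitable basis. These form an
  abelian subalgebra, so maximality of \<open>H\<close> gives equality.\<close>

lemma cartan_subalgebra_chart:
  fixes H :: "'n::finite sl set"
  assumes H: "cartan_subalgebra H"
  obtains M :: "'n sl \<Rightarrow> complex^'n^'n" where "sl_chart M" "H = {x. \<forall>i j. i \<noteq> j \<longrightarrow> M x $ i $ j = 0}"
proof -
  have ab: "abelian_subalgebra H" and max: "\<And>K. abelian_subalgebra K \<Longrightarrow> H \<subseteq> K \<Longrightarrow> K = H"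
    and diag: "\<And>x. x \<in> H \<Longrightarrow> diagonalizable_endo (bracket x)"
    using H by (auto simp: cartan_subalgebra_def)
  have comm: "A ** B = B ** A" if "A \<in> Rep_sl ` H" "B \<in> Rep_sl ` H" for A B
  proof -
    obtain x y where xy: "x \<in> H" "y \<in> H" "A = Rep_sl x" "B = Rep_sl y" using \<open>A \<in> _\<close> \<open>B \<in> _\<close> by blast
    then have "bracket x y = 0" using ab by (simp add: abelian_subalgebra_def)
    then have "Rep_sl (bracket x y) = 0" by (simp add: zero_sl.rep_eq)
    then show ?thesis by (simp add: xy bracket_sl.rep_eq)
  qed
  have ss: "semisimple_matrix A" if "A \<in> Rep_sl ` H" for A
    using that semisimple_if_ad_diagonalizable diag by blast
  obtain P Q :: "complex^'n^'n" where PQ: "P ** Q = mat 1" and QP: "Q ** P = mat 1"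
    and D: "\<And>A i j. A \<in> Rep_sl ` H \<Longrightarrow> i \<noteq> j \<Longrightarrow> (Q ** A ** P) $ i $ j = 0"
    by (rule simultaneous_diagonalization[of "Rep_sl ` H"]) (erule (1) comm | erule ss | blast)+
  define M where "M x = Q ** Rep_sl x ** P" for x
  have conj: "P ** (Q ** A ** P) ** Q = A" "Q ** (P ** A ** Q) ** P = A" for A
    using PQ QP by (simp_all add: matrix_mul_assoc) (simp_all flip: matrix_mul_assoc)
  have conj_mult: "(Q ** A ** P) ** (Q ** B ** P) = Q ** (A ** B) ** P" for A B
    using PQ by (metis matrix_mul_assoc matrix_mul_lid)
  have "sl_chart M"
  proof
    fix x y :: "'n sl" and c :: complex and i j
    show "M (x + y) = M x + M y"
      by (simp add: M_def plus_sl.rep_eq matrix_add_ldistrib matrix_add_rdist)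
    show "M (c *\<^sub>C x) $ i $ j = c * M x $ i $ j"
      by (simp add: M_def scaleC_sl.rep_eq matrix_matrix_mult_def sum_distrib_left sum_distrib_right mult_ac)
    show "M (bracket x y) = M x ** M y - M y ** M x"
      by (simp add: M_def bracket_sl.rep_eq conj_mult matrix_sub_dist)
    show "x = y" if "M x = M y"
      using that conj(1) by (metis M_def Rep_sl_inject)
    fix A
    show "(\<exists>x. M x = A) \<longleftrightarrow> trace A = 0"
    proof
      assume "\<exists>x. M x = A"
      then obtain x where "A = Q ** Rep_sl x ** P" by (auto simp: M_def)
      then have "trace A = trace (Rep_sl x)"
        using PQ by (metis trace_mul_sym matrix_mul_assoc matrix_mul_lid)
      then show "trace A = 0" using Rep_sl by simp
    next
      assume "trace A = 0"
      then have "trace (P ** A ** Q) = 0"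
        using QP by (metis trace_mul_sym matrix_mul_assoc matrix_mul_lid)
      then have "M (Abs_sl (P ** A ** Q)) = A"
        by (simp add: M_def Abs_sl_inverse conj)
      then show "\<exists>x. M x = A" by blast
    qed
  qed
  then interpret sl_chart M .
  define K where "K = {x. \<forall>i j. i \<noteq> j \<longrightarrow> M x $ i $ j = 0}"
  have M0: "M 0 = 0" using M_add[of 0 0] by simp
  have "bracket x y = 0" if "x \<in> K" "y \<in> K" for x y
  proof (rule M_inject)
    have diag_mult: "(A ** B) $ i $ j = (if i = j then A $ i $ i * B $ i $ i else 0)"
      if "\<And>i j. i \<noteq> j \<Longrightarrow> A $ i $ j = 0" "\<And>i j. i \<noteq> j \<Longrightarrow> B $ i $ j = 0"
      for A B :: "complex^'n^'n" and i j
    proof -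
      have "(A ** B) $ i $ j = (\<Sum>k\<in>UNIV. A $ i $ k * B $ k $ j)"
        by (simp add: matrix_matrix_mult_def)
      also have "\<dots> = (\<Sum>k\<in>UNIV. if k = i then A $ i $ i * B $ i $ j else 0)"
        by (intro sum.cong refl) (simp add: that(1))
      finally have "(A ** B) $ i $ j = A $ i $ i * B $ i $ j" by simp
      then show ?thesis using that by auto
    qed
    show "M (bracket x y) = M 0"
      using that by (simp add: M_bracket M0 vec_eq_iff K_def diag_mult mult.commute)
  qed
  then have "abelian_subalgebra K"
    unfolding abelian_subalgebra_def K_def
    by (auto intro!: cv.subspaceI simp: M0 M_add M_scale)
  moreover have "H \<subseteq> K" using D by (auto simp: K_def M_def)
  ultimately have "K = H" by (rule max)
  then show ?thesis using that[OF \<open>sl_chart M\<close>] unfolding K_def by blast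
qed


section \<open>Roots and Casimir elements in a chart\<close>

text \<open>The trace can be computed in any frame, that is, from vectors \<open>b s\<close> and coordinate functionals \<open>\<phi> s\<close>
  that reconstruct every vector; the \<open>b s\<close> may be linearly dependent. So the projections of all
  \<open>n\<^sup>2\<close> matrix units to the traceless matrices can be used, and no basis has to be chosen.\<close>

lemma endo_trace_frame:
  fixes b :: "'s \<Rightarrow> 'a::complex_vector" and \<phi> :: "'s \<Rightarrow> 'a \<Rightarrow> complex"
  assumes f: "clinear f" and S: "finite S"
    and \<phi>_add: "\<And>s x y. s \<in> S \<Longrightarrow> \<phi> s (x + y) = \<phi> s x + \<phi> s y"
    and \<phi>_scale: "\<And>s c x. s \<in> S \<Longrightarrow> \<phi> s (c *\<^sub>C x) = c * \<phi> s x"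
    and frame: "\<And>x. x = (\<Sum>s\<in>S. \<phi> s x *\<^sub>C b s)"
  shows "endo_trace f = (\<Sum>s\<in>S. \<phi> s (f (b s)))"
proof -
  define B where "B = (SOME B :: 'a set. cv.independent B \<and> cv.span B = UNIV)"
  have "\<exists>B :: 'a set. cv.independent B \<and> cv.span B = UNIV"
    using cv.basis_exists[of UNIV] by (metis UNIV_I subsetI subset_antisym)
  then have B: "cv.independent B" "cv.span B = UNIV"
    unfolding B_def by (metis (mono_tags, lifting) someI_ex)+
  have "x \<in> cv.span (b ` S)" for x
    by (subst frame) (simp add: cv.span_sum cv.span_scale cv.span_base)
  then have "finite B" using cv.independent_span_bound[of "b ` S" B] S B(1) by blast
  define r where "r = cv.representation B"
  have r: "(\<Sum>c\<in>B. r x c *\<^sub>C c) = x" for x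
    unfolding r_def using B \<open>finite B\<close> by (intro cv.sum_representation_eq) auto
  have r_scale: "r (c *\<^sub>C x) d = c * r x d" for c x d
    unfolding r_def using B by (simp add: cv.representation_scale)
  have r_sum: "r (sum g A) d = (\<Sum>a\<in>A. r (g a) d)" for g :: "'s \<Rightarrow> 'a" and A d
    unfolding r_def using B by (simp add: cv.representation_sum)
  have f_sum: "f (sum g A) = (\<Sum>a\<in>A. f (g a))" for g :: "'s \<Rightarrow> 'a" and A
    using clinear_scaleC[OF f, of 0 0]
    by (induction A rule: infinite_finite_induct) (simp_all add: clinear_add[OF f])
  have \<phi>_sum: "\<phi> s (sum g A) = (\<Sum>a\<in>A. \<phi> s (g a))" if "s \<in> S" for s and g :: "'a \<Rightarrow> 'a" and A
  proof (induction A rule: infinite_finite_induct)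
    case (insert x F)
    then show ?case using that by (simp add: \<phi>_add)
  qed (use \<phi>_scale[OF that, of 0 0] in simp_all)
  have "r (f c) c = (\<Sum>s\<in>S. \<phi> s c * r (f (b s)) c)" for c
    by (subst frame[of c]) (simp add: f_sum r_sum clinear_scaleC[OF f] r_scale)
  then have "endo_trace f = (\<Sum>c\<in>B. \<Sum>s\<in>S. \<phi> s c * r (f (b s)) c)"
    by (simp add: endo_trace_def B_def[symmetric] r_def[symmetric])
  also have "\<dots> = (\<Sum>s\<in>S. \<Sum>c\<in>B. \<phi> s (r (f (b s)) c *\<^sub>C c))"
    by (subst sum.swap) (simp add: \<phi>_scale mult.commute)
  also have "\<dots> = (\<Sum>s\<in>S. \<phi> s (f (b s)))"
    by (intro sum.cong refl) (simp add: r flip: \<phi>_sum)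
  finally show ?thesis .
qed

definition matrix_unit :: "'n \<Rightarrow> 'n \<Rightarrow> complex^'n^'n::finite" where
  "matrix_unit i j = (\<chi> k l. if k = i \<and> l = j then 1 else 0)"

lemma matrix_unit_mult: "matrix_unit i j ** matrix_unit k l = (if j = k then matrix_unit i l else 0)"
proof -
  have "(matrix_unit i j ** matrix_unit k l) $ p $ q = (if p = i \<and> j = k \<and> q = l then 1 else 0)" for p q
  proof -
    have "(matrix_unit i j ** matrix_unit k l) $ p $ q =
        (\<Sum>r\<in>UNIV. matrix_unit i j $ p $ r * matrix_unit k l $ r $ q)"
      by (simp add: matrix_matrix_mult_def)
    also have "\<dots> = (\<Sum>r\<in>UNIV. if r = j then (if p = i \<and> j = k \<and> q = l then 1 else 0) else 0)"
      by (intro sum.cong refl) (auto simp: matrix_unit_def)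
    finally show ?thesis by simp
  qed
  then show ?thesis by (simp add: vec_eq_iff matrix_unit_def)
qed

lemma trace_matrix_unit: "trace (matrix_unit i j) = (if i = j then 1 else 0)"
proof -
  have "trace (matrix_unit i j) = (\<Sum>k\<in>UNIV. if k = i then (if i = j then 1 else 0) else 0)"
    unfolding trace_def by (intro sum.cong refl) (auto simp: matrix_unit_def)
  then show ?thesis by simp
qed

lemma trace_mat: "trace (mat c :: complex^'n^'n) = of_nat CARD('n) * c"
  by (simp add: trace_def mat_def)

lemma commutator_shift:
  "(A - mat a) ** (B - mat b) - (B - mat b) ** (A - mat a) = A ** B - B ** (A :: complex^'n^'n)"
  by (simp add: matrix_sub_dist mat_commute[of a B] mat_commute[of b A] mat_commute[of b "mat a"])

lemma bracket_zero_right: "bracket x 0 = (0 :: 'a::complex_lie_algebra)"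
  using bracket_scaleC_right[of x 0 0] by simp

context sl_chart
begin

lemma M_zero: "M 0 = 0"
  using M_add[of 0 0] by simp

lemma M_diff: "M (x - y) = M x - M y"
  using M_add[of "x - y" y] by (simp add: algebra_simps)

lemma M_sum: "M (sum g A) = (\<Sum>a\<in>A. M (g a))"
  by (induction A rule: infinite_finite_induct) (simp_all add: M_zero M_add)

lemma trace_M: "trace (M x) = 0"
  using M_range by blast

lemma trace_M': "(\<Sum>i\<in>UNIV. M x $ i $ i) = 0"
  using trace_M by (simp add: trace_def)

text \<open>The projection of the matrix unit to the traceless matrices. Subtracting scalars does not affect
  commutators, so these elements obey the commutation rules of the matrix units of \<open>gl\<^sub>n\<close>, with diagonal
  and off-diagonal indices on an equal footing.\<close>

definition E :: "'n \<Rightarrow> 'n \<Rightarrow> 'a" where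
  "E i j = (SOME x. M x = matrix_unit i j - mat (if i = j then 1 / of_nat CARD('n) else 0))"

lemma M_E: "M (E i j) = matrix_unit i j - mat (if i = j then 1 / of_nat CARD('n) else 0)"
proof -
  have "trace (matrix_unit i j - mat (if i = j then 1 / of_nat CARD('n) else 0)) = 0"
    by (simp add: trace_sub trace_matrix_unit trace_mat)
  then have "\<exists>x. M x = matrix_unit i j - mat (if i = j then 1 / of_nat CARD('n) else 0)"
    by (simp add: M_range)
  then show ?thesis unfolding E_def by (rule someI_ex)
qed

lemma M_E_component:
  "M (E i j) $ k $ l = (if k = i \<and> l = j then 1 else 0) - (if i = j \<and> k = l then 1 / of_nat CARD('n) else 0)"
  by (simp add: M_E matrix_unit_def mat_def)

lemma bracket_E:
  "bracket (E i j) (E k l) = (if j = k then E i l else 0) - (if l = i then E k j else 0)"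
proof (rule M_inject)
  have "M (bracket (E i j) (E k l)) =
      matrix_unit i j ** matrix_unit k l - matrix_unit k l ** matrix_unit i j"
    unfolding M_bracket M_E by (rule commutator_shift)
  also have "\<dots> = M ((if j = k then E i l else 0) - (if l = i then E k j else 0))"
    by (auto simp: matrix_unit_mult M_diff M_zero M_E)
  finally show "M (bracket (E i j) (E k l)) = M ((if j = k then E i l else 0) - (if l = i then E k j else 0))" .
qed

lemma E_expansion: "x = (\<Sum>(i, j)\<in>UNIV. M x $ i $ j *\<^sub>C E i j)"
proof (rule M_inject)
  have M_sum': "M (sum g A) $ k $ l = (\<Sum>a\<in>A. M (g a) $ k $ l)" for g :: "'n \<times> 'n \<Rightarrow> 'a" and A k l
    by (simp add: M_sum)
  show "M x = M (\<Sum>(i, j)\<in>UNIV. M x $ i $ j *\<^sub>C E i j)"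
  proof (simp add: vec_eq_iff, intro allI)
    fix k l
    have "M (\<Sum>(i, j)\<in>UNIV. M x $ i $ j *\<^sub>C E i j) $ k $ l =
        (\<Sum>(i, j)\<in>UNIV. M x $ i $ j * M (E i j) $ k $ l)"
      by (simp add: M_sum' case_prod_beta M_scale)
    also have "\<dots> = (\<Sum>p\<in>UNIV. (if p = (k, l) then M x $ k $ l else 0)) -
        (\<Sum>i\<in>UNIV. \<Sum>j\<in>UNIV. if j = i then M x $ i $ i * (if k = l then 1 / of_nat CARD('n) else 0) else 0)"
      unfolding UNIV_Times_UNIV[symmetric] sum.cartesian_product sum_subtractf[symmetric]
    proof (intro sum.cong refl, clarify)
      fix i j
      show "M x $ i $ j * M (E i j) $ k $ l = (if (i, j) = (k, l) then M x $ k $ l else 0) -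
          (if j = i then M x $ i $ i * (if k = l then 1 / of_nat CARD('n) else 0) else 0)"
        by (cases "i = k"; cases "j = l"; cases "i = j"; cases "k = l")
          (simp_all add: M_E_component right_diff_distrib)
    qed
    also have "\<dots> = M x $ k $ l - (\<Sum>i\<in>UNIV. M x $ i $ i) * (if k = l then 1 / of_nat CARD('n) else 0)"
      by (simp add: sum_distrib_right)
    finally show "M x $ k $ l = M (\<Sum>(i, j)\<in>UNIV. M x $ i $ j *\<^sub>C E i j) $ k $ l"
      by (simp add: trace_M')
  qed
qed

definition torus :: "'a set" where
  "torus = {x. \<forall>i j. i \<noteq> j \<longrightarrow> M x $ i $ j = 0}"

lemma torusD: "t \<in> torus \<Longrightarrow> i \<noteq> j \<Longrightarrow> M t $ i $ j = 0"
  by (simp add: torus_def)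

lemma E_diag_in_torus: "E i i \<in> torus"
  by (auto simp: torus_def M_E_component)

lemma subspace_torus: "cv.subspace torus"
  by (auto intro!: cv.subspaceI simp: torus_def M_zero M_add M_scale)

lemma M_bracket_torus:
  assumes "t \<in> torus"
  shows "M (bracket t x) $ i $ j = (M t $ i $ i - M t $ j $ j) * M x $ i $ j"
proof -
  have "(M t ** M x) $ i $ j = (\<Sum>k\<in>UNIV. M t $ i $ k * M x $ k $ j)"
    by (simp add: matrix_matrix_mult_def)
  also have "\<dots> = (\<Sum>k\<in>UNIV. if k = i then M t $ i $ i * M x $ i $ j else 0)"
    by (intro sum.cong refl) (simp add: torusD[OF assms])
  finally have "(M t ** M x) $ i $ j = M t $ i $ i * M x $ i $ j" by simp
  moreover have "(M x ** M t) $ i $ j = M x $ i $ j * M t $ j $ j"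
  proof -
    have "(M x ** M t) $ i $ j = (\<Sum>k\<in>UNIV. M x $ i $ k * M t $ k $ j)"
      by (simp add: matrix_matrix_mult_def)
    also have "\<dots> = (\<Sum>k\<in>UNIV. if k = j then M x $ i $ j * M t $ j $ j else 0)"
      by (intro sum.cong refl) (simp add: torusD[OF assms])
    finally show ?thesis by simp
  qed
  ultimately show ?thesis by (simp add: M_bracket algebra_simps)
qed

lemma bracket_torus_E:
  assumes "t \<in> torus"
  shows "bracket t (E i j) = (M t $ i $ i - M t $ j $ j) *\<^sub>C E i j"
  by (rule M_inject) (auto simp: vec_eq_iff M_bracket_torus[OF assms] M_scale M_E_component)

text \<open>The operator \<open>ad x \<circ> ad y\<close> multiplies \<open>E i j\<close> by \<open>(x\<^sub>i - x\<^sub>j) (y\<^sub>i - y\<^sub>j)\<close>; in the sum of these factors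
  the mixed terms vanish since \<open>x\<close> and \<open>y\<close> are traceless.\<close>

lemma killing_form_torus:
  assumes x: "x \<in> torus" and y: "y \<in> torus"
  shows "killing_form x y = 2 * of_nat CARD('n) * (\<Sum>i\<in>UNIV. M x $ i $ i * M y $ i $ i)"
proof -
  let ?x = "\<lambda>i. M x $ i $ i" and ?y = "\<lambda>i. M y $ i $ i"
  have "clinear (\<lambda>z. bracket x (bracket y z))"
    by (rule clinearI) (simp_all add: bracket_add_right bracket_scaleC_right)
  moreover have "z = (\<Sum>p\<in>UNIV. M z $ fst p $ snd p *\<^sub>C E (fst p) (snd p))" for z
    using E_expansion[of z] by (simp add: case_prod_beta)
  ultimately have "killing_form x y =
      (\<Sum>p\<in>UNIV. M (bracket x (bracket y (E (fst p) (snd p)))) $ fst p $ snd p)"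
    unfolding killing_form_def
    by (intro endo_trace_frame[where \<phi> = "\<lambda>p x. M x $ fst p $ snd p" and b = "\<lambda>p. E (fst p) (snd p)"])
      (simp_all add: M_add M_scale)
  also have "\<dots> = (\<Sum>p\<in>UNIV. (?x (fst p) - ?x (snd p)) * (?y (fst p) - ?y (snd p)))"
    by (intro sum.cong refl)
      (auto simp: bracket_torus_E x y bracket_scaleC_right M_scale M_E_component)
  also have "\<dots> = (\<Sum>i\<in>UNIV. \<Sum>j\<in>UNIV. (?x i - ?x j) * (?y i - ?y j))"
    by (simp add: sum.cartesian_product case_prod_beta)
  also have "\<dots> = (\<Sum>i\<in>UNIV. of_nat CARD('n) * (?x i * ?y i) + (\<Sum>j\<in>UNIV. ?x j * ?y j))"
  proof (intro sum.cong refl)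
    fix i
    have "(\<Sum>j\<in>UNIV. (?x i - ?x j) * (?y i - ?y j)) = (\<Sum>j\<in>(UNIV :: 'n set). ?x i * ?y i)
        - ?x i * (\<Sum>j\<in>UNIV. ?y j) - (\<Sum>j\<in>UNIV. ?x j) * ?y i + (\<Sum>j\<in>UNIV. ?x j * ?y j)"
      by (simp add: algebra_simps sum.distrib sum_subtractf sum_distrib_left)
    then show "(\<Sum>j\<in>UNIV. (?x i - ?x j) * (?y i - ?y j)) =
        of_nat CARD('n) * (?x i * ?y i) + (\<Sum>j\<in>UNIV. ?x j * ?y j)"
      by (simp add: trace_M')
  qed
  also have "\<dots> = 2 * of_nat CARD('n) * (\<Sum>i\<in>UNIV. ?x i * ?y i)"
    by (simp add: sum.distrib flip: sum_distrib_left)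
  finally show ?thesis .
qed

definition sl_root :: "'n \<Rightarrow> 'n \<Rightarrow> 'a \<Rightarrow> complex" where
  "sl_root i j t = (if t \<in> torus then M t $ i $ i - M t $ j $ j else 0)"

lemma uminus_root: "(\<lambda>t. - sl_root i j t) = sl_root j i"
  by (auto simp: sl_root_def)

lemma root_eval:
  assumes "k \<noteq> l"
  shows "sl_root i j (E k k - E l l) =
    (if i = k then 1 else 0) - (if i = l then 1 else 0) - (if j = k then 1 else 0) + (if j = l then 1 else 0)"
  using assms cv.subspace_diff[OF subspace_torus E_diag_in_torus E_diag_in_torus]
  by (simp add: sl_root_def M_diff M_E_component)

lemma root_inject:
  assumes "i \<noteq> j" "sl_root i j = sl_root k l"
  shows "k = i \<and> l = j"
proof -
  have "sl_root k l (E i i - E j j) = 2"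
    using root_eval[OF assms(1), of i j] assms by simp
  then show ?thesis
    unfolding root_eval[OF assms(1)] by (auto split: if_splits)
qed

lemma root_in_dual_space: "sl_root i j \<in> dual_space torus"
  using subspace_torus
  by (auto simp: dual_space_def sl_root_def cv.subspace_add cv.subspace_scale M_add M_scale algebra_simps)

text \<open>In a chart, \<open>t\<close> scales the entry \<open>(k, l)\<close> of a root vector by \<open>t\<^sub>k - t\<^sub>l\<close>. As different pairs give
  different roots, only the entry \<open>(i, j)\<close> can be non-zero.\<close>

lemma root_space_root:
  assumes "i \<noteq> j"
  shows "root_space torus (sl_root i j) = cv.span {E i j}"
proof (intro equalityI subsetI)
  fix x assume "x \<in> cv.span {E i j}"
  then obtain c where "x = c *\<^sub>C E i j" by (auto simp: cv.span_singleton)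
  then show "x \<in> root_space torus (sl_root i j)"
    by (auto simp: root_space_def sl_root_def bracket_scaleC_right bracket_torus_E scaleC_scaleC mult.commute)
next
  fix x assume x: "x \<in> root_space torus (sl_root i j)"
  have "M x $ k $ l = M (M x $ i $ j *\<^sub>C E i j) $ k $ l" for k l
  proof (cases "k = i \<and> l = j")
    case True
    then show ?thesis using assms by (simp add: M_scale M_E_component)
  next
    case False
    then have "sl_root k l \<noteq> sl_root i j" using root_inject[OF assms] by metis
    then obtain t where t: "sl_root k l t \<noteq> sl_root i j t" by blast
    then have "t \<in> torus" by (cases "t \<in> torus") (simp_all add: sl_root_def)
    then have "sl_root i j t * M x $ k $ l = sl_root k l t * M x $ k $ l"
      using x M_bracket_torus[of t x k l] by (simp add: root_space_def M_scale sl_root_def)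
    then have "M x $ k $ l = 0" using t by simp
    then show ?thesis using assms False by (auto simp: M_scale M_E_component)
  qed
  then have "M x = M (M x $ i $ j *\<^sub>C E i j)" unfolding vec_eq_iff by blast
  then have "x = M x $ i $ j *\<^sub>C E i j" by (rule M_inject)
  then obtain c where "x = c *\<^sub>C E i j" by blast
  then show "x \<in> cv.span {E i j}" by (simp add: cv.span_scale cv.span_base)
qed

lemma E_nonzero: "i \<noteq> j \<Longrightarrow> E i j \<noteq> 0"
  using M_E_component[of i j i j] M_zero by auto

lemma roots_torus: "roots torus = {sl_root i j | i j. i \<noteq> j}"
proof (intro equalityI subsetI)
  fix \<alpha> assume "\<alpha> \<in> {sl_root i j | i j. i \<noteq> j}"
  then obtain i j where \<alpha>: "\<alpha> = sl_root i j" "i \<noteq> j" by blast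
  have "sl_root i j \<noteq> (\<lambda>_. 0)" using root_eval[OF \<alpha>(2), of i j] \<alpha>(2) by auto
  moreover have "E i j \<in> root_space torus (sl_root i j)"
    by (simp add: root_space_root \<alpha>(2) cv.span_base)
  ultimately show "\<alpha> \<in> roots torus"
    using E_nonzero[OF \<alpha>(2)] by (auto simp: roots_def \<alpha>(1) root_in_dual_space)
next
  fix \<alpha> assume \<alpha>: "\<alpha> \<in> roots torus"
  then obtain x where x: "x \<in> root_space torus \<alpha>" "x \<noteq> 0"
    unfolding roots_def root_space_def
    by (auto simp: bracket_zero_right)
  then obtain k l where kl: "M x $ k $ l \<noteq> 0"
    using M_inject[of x 0] by (auto simp: M_zero vec_eq_iff)
  have "\<alpha> t = sl_root k l t" for t
  proof (cases "t \<in> torus")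
    case True
    then have "\<alpha> t * M x $ k $ l = (M t $ k $ k - M t $ l $ l) * M x $ k $ l"
      using x(1) M_bracket_torus[of t x k l] by (simp add: root_space_def M_scale)
    then show ?thesis using kl True by (simp add: sl_root_def)
  next
    case False
    then show ?thesis using \<alpha> by (simp add: roots_def dual_space_def sl_root_def)
  qed
  then have "\<alpha> = sl_root k l" by blast
  moreover have "k \<noteq> l" using \<alpha> \<open>\<alpha> = sl_root k l\<close> by (auto simp: roots_def sl_root_def)
  ultimately show "\<alpha> \<in> {sl_root i j | i j. i \<noteq> j}" by blast
qed

end

locale sl_form = sl_chart M for M :: "'a::complex_lie_algebra \<Rightarrow> complex^'n^'n" +
  fixes B :: "'a \<Rightarrow> 'a \<Rightarrow> complex" and c :: complex
  assumes c_nonzero: "c \<noteq> 0"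
    and B_def: "B x y = c * killing_form x y"
begin

lemma B_torus_coroot:
  assumes "i \<noteq> j" "t \<in> torus"
  shows "B ((1 / (2 * of_nat CARD('n) * c)) *\<^sub>C (E i i - E j j)) t = sl_root i j t"
proof -
  have "E i i - E j j \<in> torus"
    using subspace_torus E_diag_in_torus by (simp add: cv.subspace_diff)
  then have "(1 / (2 * of_nat CARD('n) * c)) *\<^sub>C (E i i - E j j) \<in> torus"
    by (rule cv.subspace_scale[OF subspace_torus])
  then have "B ((1 / (2 * of_nat CARD('n) * c)) *\<^sub>C (E i i - E j j)) t =
     (\<Sum>k\<in>UNIV. (if k = i then M t $ i $ i else 0) - (if k = j then M t $ j $ j else 0))"
    using assms c_nonzero
    by (simp add: B_def killing_form_torus M_scale M_diff M_E_component sum_distrib_left)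
      (intro sum.cong refl, auto)
  then show ?thesis using assms(2) by (simp add: sum_subtractf sl_root_def)
qed

lemma dual_vector_root:
  assumes "i \<noteq> j"
  shows "dual_vector B torus (sl_root i j) = (1 / (2 * of_nat CARD('n) * c)) *\<^sub>C (E i i - E j j)" (is "_ = ?t")
  unfolding dual_vector_def
proof (rule the_equality)
  have "E i i - E j j \<in> torus"
    using subspace_torus E_diag_in_torus by (simp add: cv.subspace_diff)
  then have t: "?t \<in> torus" by (rule cv.subspace_scale[OF subspace_torus])
  then show "?t \<in> torus \<and> (\<forall>x\<in>torus. B ?t x = sl_root i j x)"
    using B_torus_coroot[OF assms] by blast
  fix s assume s: "s \<in> torus \<and> (\<forall>x\<in>torus. B s x = sl_root i j x)"
  define d where "d = s - ?t"
  have d: "d \<in> torus" using s t subspace_torus by (simp add: d_def cv.subspace_diff)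
  have B_diag: "B d (E k k) = 2 * of_nat CARD('n) * c * M d $ k $ k" for k
  proof -
    have "(\<Sum>i\<in>UNIV. M d $ i $ i * M (E k k) $ i $ i) =
        (\<Sum>i\<in>UNIV. (if i = k then M d $ k $ k else 0) - M d $ i $ i * (1 / of_nat CARD('n)))"
      by (intro sum.cong refl) (simp add: M_E_component algebra_simps)
    also have "\<dots> = M d $ k $ k"
      by (simp add: sum_subtractf trace_M' flip: sum_divide_distrib)
    finally show ?thesis using d by (simp add: B_def killing_form_torus E_diag_in_torus)
  qed
  have "B d (E k k) = B s (E k k) - B ?t (E k k)" for k
    using s t d by (simp add: B_def killing_form_torus E_diag_in_torus d_def M_diff
        right_diff_distrib left_diff_distrib sum_subtractf)
  then have "B d (E k k) = 0" for k
    using s B_torus_coroot[OF assms E_diag_in_torus, of k] E_diag_in_torus[of k] by simp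
  then have "M d $ k $ k = 0" for k using B_diag[of k] c_nonzero by simp
  then have "M d = 0" using torusD[OF d] by (simp add: vec_eq_iff) metis
  then have "d = 0" using M_inject[of d 0] by (simp add: M_zero)
  then show "s = ?t" by (simp add: d_def)
qed

lemma dual_form_root:
  assumes "i \<noteq> j"
  shows "dual_form B torus (sl_root i j) (sl_root i j) = 1 / (of_nat CARD('n) * c)"
proof -
  have t: "E i i - E j j \<in> torus"
    using subspace_torus E_diag_in_torus by (simp add: cv.subspace_diff)
  have "dual_form B torus (sl_root i j) (sl_root i j) = sl_root i j ((1 / (2 * of_nat CARD('n) * c)) *\<^sub>C (E i i - E j j))"
    using t subspace_torus
    by (simp add: dual_form_def dual_vector_root[OF assms] B_torus_coroot[OF assms] cv.subspace_scale)
  also have "\<dots> = (1 / (2 * of_nat CARD('n) * c)) * sl_root i j (E i i - E j j)"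
    using t cv.subspace_scale[OF subspace_torus t]
    by (simp add: sl_root_def M_scale right_diff_distrib diff_divide_distrib)
  also have "\<dots> = 1 / (of_nat CARD('n) * c)"
    using assms by (simp add: root_eval)
  finally show ?thesis .
qed

lemma coroot_root:
  assumes "i \<noteq> j"
  shows "coroot B torus (sl_root i j) = E i i - E j j"
  using c_nonzero
  by (simp add: coroot_def dual_form_root[OF assms] dual_vector_root[OF assms] scaleC_scaleC scaleC_one)

text \<open>The root vectors are \<open>p E i j\<close> and \<open>q E j i\<close>, and the normalization of their bracket forces
  \<open>p q = 1\<close>. What remains is half the squared length of the root, which is not zero.\<close>

lemma kappa_root:
  assumes ef: "root_vectors B torus e f" and "i \<noteq> j"
  shows "kappa B torus e f (sl_root i j) = (1 / (of_nat CARD('n) * c) / 2) *\<^sub>C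
    (uea_of (E i j) * uea_of (E j i) + uea_of (E j i) * uea_of (E i j))"
proof -
  have "sl_root i j \<in> roots torus" using assms(2) roots_torus by blast
  then have "e (sl_root i j) \<in> cv.span {E i j}" "f (sl_root i j) \<in> cv.span {E j i}"
    and br: "bracket (e (sl_root i j)) (f (sl_root i j)) = E i i - E j j"
    using ef assms(2) by (auto simp: root_vectors_def uminus_root root_space_root coroot_root)
  then obtain p q where pq: "e (sl_root i j) = p *\<^sub>C E i j" "f (sl_root i j) = q *\<^sub>C E j i"
    by (auto simp: cv.span_singleton)
  have "bracket (e (sl_root i j)) (f (sl_root i j)) = (p * q) *\<^sub>C (E i i - E j j)"
    using assms(2) by (simp add: pq bracket_scaleC_left bracket_scaleC_right bracket_E scaleC_scaleC)
  then have "(p * q - 1) *\<^sub>C (E i i - E j j) = 0"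
    using br by (simp add: cv.scale_left_diff_distrib scaleC_one)
  moreover have "E i i - E j j \<noteq> 0"
  proof
    assume "E i i - E j j = 0"
    then have "sl_root i j (E i i - E j j) = 0" by (simp add: sl_root_def M_zero)
    then show False using root_eval[OF assms(2), of i j] assms(2) by simp
  qed
  ultimately have "p * q = 1" by (metis cv.scale_eq_0_iff eq_iff_diff_eq_0)
  then show ?thesis
    by (simp add: kappa_def pq dual_form_root[OF assms(2)] uea_of_scaleC mult_scaleC_left
        mult_scaleC_right scaleC_scaleC mult.commute[of q p] scaleC_one cv.scale_right_distrib)
qed

end


section \<open>Words in the enveloping algebra\<close>

lemma subalgebra_subspace: "subalgebra A \<Longrightarrow> cv.subspace A"
  by (simp add: subalgebra_def)

lemma subalgebra_one: "subalgebra A \<Longrightarrow> 1 \<in> A"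
  by (simp add: subalgebra_def)

lemma subalgebra_mult: "subalgebra A \<Longrightarrow> x \<in> A \<Longrightarrow> y \<in> A \<Longrightarrow> x * y \<in> A"
  by (simp add: subalgebra_def)

lemma subalgebra_add: "subalgebra A \<Longrightarrow> x \<in> A \<Longrightarrow> y \<in> A \<Longrightarrow> x + y \<in> A"
  by (simp add: subalgebra_def cv.subspace_add)

lemma subalgebra_diff: "subalgebra A \<Longrightarrow> x \<in> A \<Longrightarrow> y \<in> A \<Longrightarrow> x - y \<in> A"
  by (simp add: subalgebra_def cv.subspace_diff)

lemma subalgebra_scaleC: "subalgebra A \<Longrightarrow> x \<in> A \<Longrightarrow> c *\<^sub>C x \<in> A"
  by (simp add: subalgebra_def cv.subspace_scale)

lemma subalgebra_zero: "subalgebra A \<Longrightarrow> 0 \<in> A"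
  by (simp add: subalgebra_def cv.subspace_0)

lemma subalgebra_hull: "subalgebra (subalgebra hull S)"
  by (rule hull_in) (auto simp: subalgebra_def cv.subspace_def)

lemma subalgebra_hull_minimal: "S \<subseteq> A \<Longrightarrow> subalgebra A \<Longrightarrow> subalgebra hull S \<subseteq> A"
  by (rule hull_minimal)

lemma subalgebra_centralizer: "subalgebra (centralizer S)"
  unfolding subalgebra_def centralizer_def
  by (auto intro!: cv.subspaceI simp: distrib_left distrib_right mult_scaleC_left mult_scaleC_right)
    (metis mult.assoc)

lemma uea_of_zero: "uea_of 0 = 0"
  using uea_of_scaleC[of 0 0] by simp

lemma uea_of_diff: "uea_of (x - y) = uea_of x - uea_of y"
  using uea_of_add[of "x - y" y] by (simp add: algebra_simps)

lemma uea_of_sum: "uea_of (sum g A) = (\<Sum>a\<in>A. uea_of (g a))"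
  by (induction A rule: infinite_finite_induct) (simp_all add: uea_of_zero uea_of_add)

lemma uea_spanned_by_products:
  "(z :: 'a::complex_lie_algebra uea) \<in> cv.span (range (\<lambda>xs. prod_list (map uea_of xs)))"
proof (induction z rule: uea.abs_induct)
  case (1 p)
  have abs_single: "abs_uea (Poly_Mapping.single (Word xs) c) = c *\<^sub>C prod_list (map uea_of xs)"
    for xs :: "'a list" and c
  proof (induction xs)
    case Nil
    show ?case
      by (simp add: one_uea_def scaleC_uea.abs_eq zero_word_def)
  next
    case (Cons x xs)
    have "Poly_Mapping.single (Word (x # xs)) c = free_gen x * Poly_Mapping.single (Word xs) c"
      by (simp add: free_gen_def mult_single plus_word_def)
    then show ?case
      by (simp add: times_uea.abs_eq[symmetric] uea_of.abs_eq[symmetric] Cons.IH mult_scaleC_right)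
  qed
  show ?case
  proof (induction p rule: free_alg_induct)
    case zero
    show ?case by (simp add: zero_uea_def[symmetric] cv.span_zero)
  next
    case (single w c)
    show ?case by (cases w) (auto simp: abs_single intro!: cv.span_scale intro: cv.span_base)
  next
    case (add p q)
    then show ?case by (simp add: plus_uea.abs_eq[symmetric] cv.span_add)
  qed
qed

text \<open>Viewing \<open>(i, j)\<close> as an edge from \<open>i\<close> to \<open>j\<close>, every vertex has as many outgoing as incoming edges.\<close>

definition balanced :: "('n \<times> 'n) list \<Rightarrow> bool" where
  "balanced w \<longleftrightarrow> image_mset fst (mset w) = image_mset snd (mset w)"

context sl_chart
begin

definition u :: "'n \<Rightarrow> 'n \<Rightarrow> 'a uea" where
  "u i j = uea_of (E i j)"

definition mon :: "('n \<times> 'n) list \<Rightarrow> 'a uea" where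
  "mon w = prod_list (map (\<lambda>(i, j). u i j) w)"

lemma mon_simps: "mon [] = 1" "mon ((i, j) # w) = u i j * mon w"
  by (simp_all add: mon_def)

lemma mon_append: "mon (v @ w) = mon v * mon w"
  by (simp add: mon_def)

lemma u_commutator: "u i j * u k l - u k l * u i j = (if j = k then u i l else 0) - (if l = i then u k j else 0)"
  unfolding u_def uea_of_bracket[symmetric] bracket_E by (simp add: uea_of_diff uea_of_zero)

lemma u_swap: "u i j * u k l = u k l * u i j + (if j = k then u i l else 0) - (if l = i then u k j else 0)"
  using u_commutator[of i j k l] by (simp add: algebra_simps)

lemma uea_of_expansion: "uea_of x = (\<Sum>(i, j)\<in>UNIV. M x $ i $ j *\<^sub>C u i j)"
  by (subst E_expansion) (simp add: uea_of_sum case_prod_beta uea_of_scaleC u_def)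

lemma span_mon: "cv.span (range mon) = UNIV"
proof -
  have mult: "u i j * p \<in> cv.span (range mon)" if "p \<in> cv.span (range mon)" for i j p
    using that
  proof (induction rule: cv.span_induct_alt)
    case base
    show ?case by (simp add: cv.span_zero)
  next
    case (step c x y)
    then obtain w where "x = mon w" by blast
    then have "u i j * x = mon ((i, j) # w)" by (simp add: mon_simps)
    then show ?case using step
      by (auto simp: distrib_left mult_scaleC_right intro!: cv.span_add cv.span_scale intro: cv.span_base)
  qed
  have "prod_list (map uea_of xs) \<in> cv.span (range mon)" for xs
  proof (induction xs)
    case Nil
    show ?case using cv.span_base[OF rangeI[of mon "[]"]] by (simp add: mon_simps)
  next
    case (Cons x xs)
    then show ?case
      by (auto simp: uea_of_expansion[of x] sum_distrib_right mult_scaleC_left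
          intro!: cv.span_sum cv.span_scale mult)
  qed
  then have "cv.span (range (\<lambda>xs. prod_list (map uea_of xs))) \<subseteq> cv.span (range mon)"
    by (intro cv.span_minimal) auto
  then show ?thesis using uea_spanned_by_products by blast
qed

definition weight :: "'a \<Rightarrow> ('n \<times> 'n) list \<Rightarrow> complex" where
  "weight t w = (\<Sum>(i, j)\<leftarrow>w. M t $ i $ i - M t $ j $ j)"

lemma weight_simps: "weight t [] = 0" "weight t ((i, j) # w) = M t $ i $ i - M t $ j $ j + weight t w"
  by (simp_all add: weight_def)

lemma torus_mon:
  assumes "t \<in> torus"
  shows "uea_of t * mon w - mon w * uea_of t = weight t w *\<^sub>C mon w"
proof (induction w)
  case Nil
  show ?case by (simp add: mon_simps weight_simps)
next
  case (Cons p w)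
  obtain i j where p: "p = (i, j)" by (cases p)
  have "uea_of t * u i j - u i j * uea_of t = (M t $ i $ i - M t $ j $ j) *\<^sub>C u i j"
    unfolding u_def uea_of_bracket[symmetric] bracket_torus_E[OF assms] by (rule uea_of_scaleC)
  moreover have "uea_of t * mon (p # w) - mon (p # w) * uea_of t =
      (uea_of t * u i j - u i j * uea_of t) * mon w + u i j * (uea_of t * mon w - mon w * uea_of t)"
    by (simp add: p mon_simps algebra_simps)
  ultimately show ?case
    by (simp add: Cons.IH p mon_simps weight_simps mult_scaleC_left mult_scaleC_right scaleC_add_left)
qed

lemma weight_eq: "weight t w =
    sum_mset (image_mset (\<lambda>i. M t $ i $ i) (image_mset fst (mset w))) -
    sum_mset (image_mset (\<lambda>i. M t $ i $ i) (image_mset snd (mset w)))"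
  by (induction w) (auto simp: weight_def)

lemma weight_balanced: "balanced w \<Longrightarrow> weight t w = 0"
  by (simp add: weight_eq balanced_def)

text \<open>Exchanging two neighbouring letters changes the product by words in which the two letters are merged
  into one; these are shorter and still balanced. The fixed prefix \<open>c\<close> is there for the induction, which
  sorts the word from left to right.\<close>

lemma mon_permute:
  assumes A: "subalgebra A"
    and short: "\<And>v. balanced v \<Longrightarrow> length v < n \<Longrightarrow> mon v \<in> A"
    and "balanced (c @ w)" "length (c @ w) = n" "mset w = mset w'"
  shows "mon (c @ w) - mon (c @ w') \<in> A"
proof -
  have transpose: "mon (c @ p # q # b) - mon (c @ q # p # b) \<in> A"
    if bal: "balanced (c @ p # q # b)" and len: "length (c @ p # q # b) = n" for c p q b
  proof -
    obtain i j k l where pq: "p = (i, j)" "q = (k, l)" by (cases p, cases q)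
    have "mon (c @ p # q # b) - mon (c @ q # p # b) =
        mon c * (u i j * u k l - u k l * u i j) * mon b"
      by (simp add: mon_append mon_simps pq algebra_simps)
    also have "\<dots> = (if j = k then mon (c @ (i, l) # b) else 0) - (if l = i then mon (c @ (k, j) # b) else 0)"
      unfolding u_commutator by (auto simp: mon_append mon_simps algebra_simps)
    also have "\<dots> \<in> A"
    proof (rule subalgebra_diff[OF A])
      show "(if j = k then mon (c @ (i, l) # b) else 0) \<in> A"
        using bal len by (auto simp: pq balanced_def subalgebra_zero[OF A] intro!: short)
      show "(if l = i then mon (c @ (k, j) # b) else 0) \<in> A"
        using bal len by (auto simp: pq balanced_def subalgebra_zero[OF A] intro!: short)
    qed
    finally show ?thesis .
  qed
  have bal_perm: "balanced v \<longleftrightarrow> balanced v'" if "mset v = mset v'" for v v' :: "('n \<times> 'n) list"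
    using that by (simp add: balanced_def)
  have trans: "x - z \<in> A" if "x - y \<in> A" "y - z \<in> A" for x y z
    using subalgebra_add[OF A that] by simp
  have to_front: "mon (c @ a @ p # b) - mon (c @ p # a @ b) \<in> A"
    if "balanced (c @ a @ p # b)" "length (c @ a @ p # b) = n" for c a p b
    using that
  proof (induction a arbitrary: b rule: rev_induct)
    case Nil
    show ?case by (simp add: subalgebra_zero[OF A])
  next
    case (snoc q a)
    have "mon ((c @ a) @ q # p # b) - mon ((c @ a) @ p # q # b) \<in> A"
      using snoc.prems by (intro transpose) simp_all
    moreover have "mon (c @ a @ p # (q # b)) - mon (c @ p # a @ (q # b)) \<in> A"
    proof (rule snoc.IH)
      show "balanced (c @ a @ p # q # b)"
        by (rule bal_perm[THEN iffD1, OF _ snoc.prems(1)]) simp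
    qed (use snoc.prems(2) in simp)
    ultimately show ?case by (simp add: trans)
  qed
  show ?thesis
    using assms(3-5)
  proof (induction w' arbitrary: w c)
    case Nil
    then show ?case by (simp add: subalgebra_zero[OF A])
  next
    case (Cons p v)
    then have "p \<in> set w" by (metis list.set_intros(1) mset_eq_setD)
    then obtain a b where w: "w = a @ p # b" by (meson split_list)
    have "mon (c @ w) - mon (c @ p # a @ b) \<in> A"
      unfolding w by (rule to_front) (use Cons.prems in \<open>simp_all add: w\<close>)
    moreover have "mon ((c @ [p]) @ (a @ b)) - mon ((c @ [p]) @ v) \<in> A"
    proof (rule Cons.IH)
      show "balanced ((c @ [p]) @ a @ b)"
        by (rule bal_perm[THEN iffD1, OF _ Cons.prems(1)]) (simp add: w)
    qed (use Cons.prems in \<open>simp_all add: w\<close>)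
    ultimately show ?case by (simp add: trans)
  qed
qed

text \<open>The commutator with \<open>u a b\<close> acts on the three factors in turn by the commutation rules,
  and the six resulting double sums cancel in pairs.\<close>

lemma cubic_casimir_central:
  "(\<Sum>i\<in>UNIV. \<Sum>j\<in>UNIV. \<Sum>k\<in>UNIV. u i j * u j k * u k i) \<in> centre" (is "?z \<in> _")
proof -
  have delta1: "(\<Sum>i\<in>UNIV. \<Sum>j\<in>UNIV. \<Sum>k\<in>UNIV. if i = b then F i j k else 0) = (\<Sum>j\<in>UNIV. \<Sum>k\<in>UNIV. F b j k)"
    for F :: "'n \<Rightarrow> 'n \<Rightarrow> 'n \<Rightarrow> 'a uea" and b
  proof -
    have "(\<Sum>j\<in>UNIV. \<Sum>k\<in>UNIV. if i = b then F i j k else 0) =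
        (if i = b then \<Sum>j\<in>UNIV. \<Sum>k\<in>UNIV. F i j k else 0)" for i
      by simp
    then show ?thesis by simp
  qed
  have delta2: "(\<Sum>i\<in>UNIV. \<Sum>j\<in>UNIV. \<Sum>k\<in>UNIV. if j = b then F i j k else 0) = (\<Sum>i\<in>UNIV. \<Sum>k\<in>UNIV. F i b k)"
    for F :: "'n \<Rightarrow> 'n \<Rightarrow> 'n \<Rightarrow> 'a uea" and b
  proof -
    have "(\<Sum>k\<in>UNIV. if j = b then F i j k else 0) = (if j = b then \<Sum>k\<in>UNIV. F i j k else 0)" for i j
      by simp
    then show ?thesis by simp
  qed
  have delta3: "(\<Sum>i\<in>UNIV. \<Sum>j\<in>UNIV. \<Sum>k\<in>UNIV. if k = b then F i j k else 0) = (\<Sum>i\<in>UNIV. \<Sum>j\<in>UNIV. F i j b)"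
    for F :: "'n \<Rightarrow> 'n \<Rightarrow> 'n \<Rightarrow> 'a uea" and b
    by simp
  have "?z * u a b = u a b * ?z" for a b
  proof -
    have D: "u a b * u p q - u p q * u a b = (if p = b then u a q else 0) - (if q = a then u p b else 0)" for p q
      using u_commutator[of a b p q] by auto
    have ad: "u a b * (u i j * u j k * u k i) - u i j * u j k * u k i * u a b =
        (if i = b then u a j * u j k * u k i else 0) - (if j = a then u i b * u j k * u k i else 0) +
        (if j = b then u i j * u a k * u k i else 0) - (if k = a then u i j * u j b * u k i else 0) +
        (if k = b then u i j * u j k * u a i else 0) - (if i = a then u i j * u j k * u k b else 0)" for i j k
    proof -
      have "u a b * (u i j * u j k * u k i) - u i j * u j k * u k i * u a b =
          (u a b * u i j - u i j * u a b) * u j k * u k i +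
          u i j * (u a b * u j k - u j k * u a b) * u k i +
          u i j * u j k * (u a b * u k i - u k i * u a b)"
        by (simp add: algebra_simps)
      then show ?thesis
        unfolding D by (simp only:) (auto simp: algebra_simps)
    qed
    have "u a b * ?z - ?z * u a b = (\<Sum>i\<in>UNIV. \<Sum>j\<in>UNIV. \<Sum>k\<in>UNIV.
        u a b * (u i j * u j k * u k i) - u i j * u j k * u k i * u a b)"
      by (simp add: sum_distrib_left sum_distrib_right sum_subtractf)
    also have "\<dots> = 0"
      unfolding ad sum.distrib sum_subtractf delta1 delta2 delta3 by simp
    finally have "u a b * ?z - ?z * u a b = 0" .
    then show ?thesis by simp
  qed
  then have u: "u a b \<in> centralizer {?z}" for a b
    by (simp add: centralizer_def)
  have "mon w \<in> centralizer {?z}" for w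
    by (induction w)
      (auto simp: mon_simps intro!: u subalgebra_mult[OF subalgebra_centralizer]
        subalgebra_one[OF subalgebra_centralizer])
  then have "cv.span (range mon) \<subseteq> centralizer {?z}"
    using subalgebra_subspace[OF subalgebra_centralizer] by (intro cv.span_minimal) auto
  then show ?thesis
    unfolding span_mon centralizer_def by (auto simp: subset_eq)
qed

end


section \<open>The zero weight subalgebra for three by three matrices\<close>

lemma length_eq_counts: "length xs = count (mset xs) (1::3) + count (mset xs) 2 + count (mset xs) 3"
proof (induction xs)
  case (Cons x xs)
  then show ?case using exhaust_3[of x] by auto
qed simp

inductive_set cycles :: "('n \<times> 'n) list set" where
  loop: "[(i, i)] \<in> cycles"
| digon: "i \<noteq> j \<Longrightarrow> [(i, j), (j, i)] \<in> cycles"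
| triangle: "i \<noteq> j \<Longrightarrow> j \<noteq> k \<Longrightarrow> k \<noteq> i \<Longrightarrow> [(i, j), (j, k), (k, i)] \<in> cycles"

text \<open>Follow the edges from any vertex: by balance one can always leave the vertex just reached, and on
  three vertices the walk closes up within three steps.\<close>

lemma balanced_contains_cycle:
  fixes W :: "(3 \<times> 3) multiset"
  assumes bal: "image_mset fst W = image_mset snd W" and "W \<noteq> {#}"
  shows "\<exists>c V. c \<in> cycles \<and> W = mset c + V"
proof -
  have out: "\<exists>k V'. V = add_mset (j, k) V'" if j: "j \<in># image_mset fst V" for j :: 3 and V :: "(3 \<times> 3) multiset"
  proof -
    obtain p where p: "p \<in># V" "j = fst p" using j by auto
    then have "V = add_mset (j, snd p) (V - {#p#})" by simp
    then show ?thesis by blast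
  qed
  obtain p W1 where "W = add_mset p W1"
    using assms(2) by (cases W rule: multiset_cases) blast+
  then obtain i j where W: "W = add_mset (i, j) W1" by (cases p) simp
  have cycle: ?thesis if "c \<in> cycles" "W = mset c + V" for c V
    using that by blast
  show ?thesis
  proof (cases "i = j")
    case True
    then have "W = mset [(i, i)] + W1" by (simp add: W)
    then show ?thesis by (rule cycle[OF loop])
  next
    case ij: False
    have "add_mset i (image_mset fst W1) = add_mset j (image_mset snd W1)"
      using bal by (simp add: W)
    then have "j \<in># image_mset fst W1" using ij by (metis insert_noteq_member)
    then obtain k W2 where W1: "W1 = add_mset (j, k) W2" using out by blast
    consider "k = j" | "k = i" | "k \<noteq> i" "k \<noteq> j" by blast
    then show ?thesis
    proof cases
      case 1
      then have "W = mset [(j, j)] + add_mset (i, j) W2" by (simp add: W W1)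
      then show ?thesis by (rule cycle[OF loop])
    next
      case 2
      then have "W = mset [(i, j), (j, i)] + W2" by (simp add: W W1)
      then show ?thesis by (rule cycle[OF digon[OF ij]])
    next
      case 3
      have eq: "add_mset i (image_mset fst W2) = add_mset k (image_mset snd W2)"
        using bal by (simp add: W W1 add_mset_commute)
      have "k \<in># add_mset i (image_mset fst W2)" unfolding eq by simp
      then have "k \<in># image_mset fst W2" using 3 by auto
      then obtain l W3 where W2: "W2 = add_mset (k, l) W3" using out by blast
      have "l = i \<or> l = j \<or> l = k"
        using ij 3 exhaust_3[of i] exhaust_3[of j] exhaust_3[of k] exhaust_3[of l] by auto
      then show ?thesis
      proof (elim disjE)
        assume "l = k"
        then have "W = mset [(k, k)] + add_mset (i, j) (add_mset (j, k) W3)"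
          by (simp add: W W1 W2)
        then show ?thesis by (rule cycle[OF loop])
      next
        assume "l = j"
        then have "W = mset [(j, k), (k, j)] + add_mset (i, j) W3" by (simp add: W W1 W2)
        then show ?thesis by (rule cycle[OF digon[OF 3(2)[symmetric]]])
      next
        assume "l = i"
        then have "W = mset [(i, j), (j, k), (k, i)] + W3" by (simp add: W W1 W2)
        then show ?thesis by (rule cycle[OF triangle[OF ij 3(2)[symmetric] 3(1)]])
      qed
    qed
  qed
qed

locale sl3_chart = sl_chart M for M :: "'a::complex_lie_algebra \<Rightarrow> complex^3^3"
begin

text \<open>An element of the torus that detects balance on its own: the real and the imaginary part of its weight
  on a word are the excess of rows over columns for the index \<open>1\<close> and the index \<open>2\<close>.\<close>

definition h0 :: 'a where
  "h0 = E 1 1 + \<i> *\<^sub>C E 2 2"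

lemma h0_torus: "h0 \<in> torus"
  unfolding h0_def using subspace_torus E_diag_in_torus
  by (intro cv.subspace_add cv.subspace_scale)

text \<open>The shift by \<open>(1 + \<i>) / 3\<close>, which makes \<open>h0\<close> traceless, enters the row and the column count with the
  same multiplicity, the length of the word, and cancels. The third index is then balanced because
  row and column indices are equally many.\<close>

lemma balanced_iff_weight: "balanced w \<longleftrightarrow> weight h0 w = 0"
proof
  assume w: "weight h0 w = 0"
  define r where "r = (1 + \<i>) / 3"
  have h0_diag: "M h0 $ 1 $ 1 = 1 - r" "M h0 $ 2 $ 2 = \<i> - r" "M h0 $ 3 $ 3 = - r"
    by (simp_all add: r_def h0_def M_add M_scale M_E_component algebra_simps add_divide_distrib)
  have sum: "sum_mset (image_mset (\<lambda>i. M h0 $ i $ i) (mset xs)) =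
      of_nat (count (mset xs) 1) + \<i> * of_nat (count (mset xs) 2) - of_nat (length xs) * r" for xs :: "3 list"
  proof (induction xs)
    case (Cons x xs)
    then show ?case using exhaust_3[of x] by (auto simp: h0_diag algebra_simps)
  qed simp
  let ?a = "mset (map fst w)" and ?b = "mset (map snd w)"
  have "of_nat (count ?a 1) + \<i> * of_nat (count ?a 2) = of_nat (count ?b 1) + \<i> * of_nat (count ?b 2)"
    using w sum[of "map fst w"] sum[of "map snd w"] by (simp add: weight_eq)
  then have "count ?a 1 = count ?b 1" "count ?a 2 = count ?b 2"
    by (auto simp: complex_eq_iff)
  moreover from this have "count ?a 3 = count ?b 3"
    using length_eq_counts[of "map fst w"] length_eq_counts[of "map snd w"] by simp
  ultimately have "count ?a i = count ?b i" for i using exhaust_3[of i] by auto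
  then have "?a = ?b" by (rule multiset_eqI)
  then show "balanced w" by (simp add: balanced_def)
qed (rule weight_balanced)

text \<open>Induction on the length: permute the word such that it starts with a cycle. The permutation costs
  shorter balanced words only, and the rest of the word is balanced again.\<close>

lemma mon_balanced_in_subalgebra:
  assumes A: "subalgebra A" and cyc: "\<And>c. c \<in> cycles \<Longrightarrow> mon c \<in> A"
  shows "balanced w \<Longrightarrow> mon w \<in> A"
proof (induction "length w" arbitrary: w rule: less_induct)
  case less
  show ?case
  proof (cases "w = []")
    case True
    then show ?thesis by (simp add: mon_simps subalgebra_one[OF A])
  next
    case False
    then obtain c V where cV: "c \<in> cycles" "mset w = mset c + V"
      using balanced_contains_cycle[of "mset w"] less.prems by (auto simp: balanced_def)
    obtain v where v: "V = mset v" by (metis ex_mset)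
    have c: "c \<noteq> []" "image_mset fst (mset c) = image_mset snd (mset c)"
      using cV(1) by (cases, auto)+
    have "balanced v" using less.prems c(2) cV(2) by (simp add: balanced_def v)
    moreover have "length w = length c + length v"
      using cV(2) by (metis size_mset size_union v)
    ultimately have "mon v \<in> A" using c(1) by (intro less.hyps) auto
    then have "mon (c @ v) \<in> A" using cyc[OF cV(1)] by (simp add: mon_append subalgebra_mult[OF A])
    moreover have "mon ([] @ w) - mon ([] @ c @ v) \<in> A"
      using less.hyps less.prems cV(2) by (intro mon_permute[OF A]) (simp_all add: v)
    ultimately have "mon w - mon (c @ v) + mon (c @ v) \<in> A"
      by (intro subalgebra_add[OF A]) simp_all
    then show ?thesis by simp
  qed
qed

lemma centralizer_torus: "centralizer (uea_of ` torus) = cv.span (mon ` {w. balanced w})"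
proof (intro equalityI subsetI)
  interpret T: complex_endomorphism scaleC "\<lambda>z. uea_of h0 * z - z * uea_of h0"
    by unfold_locales
      (simp_all add: algebra_simps mult_scaleC_left mult_scaleC_right)
  fix z assume "z \<in> centralizer (uea_of ` torus)"
  then have "uea_of h0 * z - z * uea_of h0 = 0" using h0_torus by (simp add: centralizer_def)
  then have "z \<in> cv.span (mon ` {w \<in> UNIV. weight h0 w = 0})"
    by (intro T.kernel_on_span_of_eigenvectors) (simp_all add: torus_mon[OF h0_torus] span_mon)
  then show "z \<in> cv.span (mon ` {w. balanced w})" by (simp add: balanced_iff_weight)
next
  have "mon ` {w. balanced w} \<subseteq> centralizer (uea_of ` torus)"
  proof
    fix x assume "x \<in> mon ` {w. balanced w}"
    then obtain w where w: "balanced w" "x = mon w" by blast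
    have "uea_of t * mon w = mon w * uea_of t" if "t \<in> torus" for t
      using torus_mon[OF that, of w] weight_balanced[OF w(1)] by simp
    then show "x \<in> centralizer (uea_of ` torus)" by (auto simp: centralizer_def w(2))
  qed
  then show "z \<in> centralizer (uea_of ` torus)" if "z \<in> cv.span (mon ` {w. balanced w})" for z
    using that cv.span_minimal[OF _ subalgebra_subspace[OF subalgebra_centralizer]] by blast
qed

text \<open>The Casimir algebra of the torus, with the normalization of the form and of the root vectors removed
  from its generators.\<close>

definition casimir :: "'a uea set" where
  "casimir = subalgebra hull ({u i j * u j i + u j i * u i j | i j. i \<noteq> j} \<union> uea_of ` torus)"

lemma subalgebra_casimir: "subalgebra casimir"
  unfolding casimir_def by (rule subalgebra_hull)

lemma u_diag_in_casimir: "u i i \<in> casimir"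
  unfolding casimir_def u_def using E_diag_in_torus
  by (intro subsetD[OF hull_subset]) blast

lemma digon_in_casimir: "u i j * u j i \<in> casimir"
proof (cases "i = j")
  case True
  then show ?thesis
    using subalgebra_mult[OF subalgebra_casimir] u_diag_in_casimir by simp
next
  case False
  have "u i j * u j i + u j i * u i j \<in> casimir"
    unfolding casimir_def using False by (intro subsetD[OF hull_subset]) blast
  moreover have "u i i - u j j \<in> casimir"
    by (intro subalgebra_diff[OF subalgebra_casimir] u_diag_in_casimir)
  ultimately have "u i j * u j i + u j i * u i j + (u i i - u j j) \<in> casimir"
    by (rule subalgebra_add[OF subalgebra_casimir])
  then have "(1 / 2) *\<^sub>C (u i j * u j i + u j i * u i j + (u i i - u j j)) \<in> casimir"
    by (rule subalgebra_scaleC[OF subalgebra_casimir])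
  also have "u i j * u j i + u j i * u i j + (u i i - u j j) = u i j * u j i + u i j * u j i"
    using u_swap[of i j j i] by simp
  also have "(1 / 2) *\<^sub>C \<dots> = u i j * u j i"
    by (simp add: scaleC_add_left[symmetric] scaleC_add_right scaleC_one)
  finally show ?thesis .
qed

definition tri :: "3 \<Rightarrow> 3 \<Rightarrow> 3 \<Rightarrow> 'a uea" where
  "tri i j k = u i j * u j k * u k i"

lemma tri_rotate:
  assumes "i \<noteq> j" "j \<noteq> k" "k \<noteq> i"
  shows "tri i j k - tri j k i \<in> casimir"
proof -
  have "tri i j k - tri j k i = (u i j * u j k - u j k * u i j) * u k i + u j k * (u i j * u k i - u k i * u i j)"
    by (simp add: tri_def algebra_simps)
  also have "\<dots> = u i k * u k i - u j k * u k j"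
    using assms by (simp add: u_commutator)
  also have "\<dots> \<in> casimir"
    by (intro subalgebra_diff[OF subalgebra_casimir] digon_in_casimir)
  finally show ?thesis .
qed

text \<open>The commutator of two two-cycles that share one vertex: of its four terms two survive, the three-cycles
  of either orientation.\<close>

lemma tri_reverse:
  assumes "i \<noteq> j" "j \<noteq> k" "k \<noteq> i"
  shows "tri i k j - tri i j k \<in> casimir"
proof -
  have "(u i j * u j i) * (u j k * u k j) - (u j k * u k j) * (u i j * u j i) =
      u i j * u j k * (u j i * u k j - u k j * u j i) + u i j * (u j i * u j k - u j k * u j i) * u k j
      + (u i j * u j k - u j k * u i j) * u k j * u j i + u j k * (u i j * u k j - u k j * u i j) * u j i"
    by (simp add: algebra_simps)
  also have "\<dots> = tri i k j - tri i j k"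
    using assms by (simp add: u_commutator tri_def)
  finally have "tri i k j - tri i j k =
      (u i j * u j i) * (u j k * u k j) - (u j k * u k j) * (u i j * u j i)" ..
  also have "\<dots> \<in> casimir"
    by (intro subalgebra_diff[OF subalgebra_casimir] subalgebra_mult[OF subalgebra_casimir] digon_in_casimir)
  finally show ?thesis .
qed

lemma tri_congruent:
  assumes "i \<noteq> j" "j \<noteq> k" "k \<noteq> i"
  shows "tri i j k - tri 1 2 3 \<in> casimir"
proof -
  have trans: "x - z \<in> casimir" if "x - y \<in> casimir" "y - z \<in> casimir" for x y z
    using subalgebra_add[OF subalgebra_casimir that] by simp
  have sym: "y - x \<in> casimir" if "x - y \<in> casimir" for x y
    using subalgebra_scaleC[OF subalgebra_casimir that, of "-1"] by simp
  have a: "tri 3 1 2 - tri 1 2 3 \<in> casimir" by (rule tri_rotate) auto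
  have b: "tri 2 3 1 - tri 1 2 3 \<in> casimir" by (rule trans[OF tri_rotate a]) auto
  have c: "tri 1 3 2 - tri 1 2 3 \<in> casimir" by (rule tri_reverse) auto
  have d: "tri 2 1 3 - tri 1 2 3 \<in> casimir" by (rule trans[OF tri_rotate c]) auto
  have e: "tri 3 2 1 - tri 1 2 3 \<in> casimir" by (rule trans[OF tri_rotate d]) auto
  have "tri 1 2 3 - tri 1 2 3 \<in> casimir" by (simp add: subalgebra_zero[OF subalgebra_casimir])
  then show ?thesis
    using exhaust_3[of i] exhaust_3[of j] exhaust_3[of k]
    by (elim disjE) (use assms a b c d e in simp_all)
qed

lemma tri_degenerate:
  assumes "i = j \<or> j = k \<or> k = i"
  shows "tri i j k \<in> casimir"
proof -
  note mult = subalgebra_mult[OF subalgebra_casimir]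
  consider "i = j" | "j = k" | "k = i" using assms by blast
  then show ?thesis
  proof cases
    case 1
    then show ?thesis
      using mult[OF u_diag_in_casimir digon_in_casimir] by (simp add: tri_def mult.assoc)
  next
    case 2
    have "tri i j j = u j j * (u i j * u j i) + (u i j * u j j - u j j * u i j) * u j i"
      by (simp add: tri_def algebra_simps)
    also have "\<dots> = u j j * (u i j * u j i) + (u i j * u j i - (if j = i then u j j * u j i else 0))"
      by (simp add: u_commutator left_diff_distrib)
    also have "\<dots> \<in> casimir"
      by (auto intro!: subalgebra_add[OF subalgebra_casimir] subalgebra_diff[OF subalgebra_casimir]
          mult u_diag_in_casimir digon_in_casimir subalgebra_zero[OF subalgebra_casimir])
    finally show ?thesis using 2 by simp
  next
    case 3
    then show ?thesis
      using mult[OF digon_in_casimir u_diag_in_casimir] by (simp add: tri_def)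
  qed
qed

text \<open>Modulo the Casimir algebra, the terms of the cubic Casimir element with a repeated index vanish and
  the other six agree.\<close>

lemma tri_in_subalgebra:
  assumes A: "subalgebra A" "casimir \<subseteq> A" "centre \<subseteq> A"
    and ijk: "i \<noteq> j" "j \<noteq> k" "k \<noteq> i"
  shows "tri i j k \<in> A"
proof -
  let ?z = "\<Sum>i\<in>UNIV. \<Sum>j\<in>UNIV. \<Sum>k\<in>UNIV. tri i j k"
  define d where "d i j k = tri i j k - (if i \<noteq> j \<and> j \<noteq> k \<and> k \<noteq> i then tri 1 2 3 else 0)" for i j k
  have "d i j k \<in> casimir" for i j k
    using tri_congruent[of i j k] tri_degenerate[of i j k] by (auto simp: d_def)
  then have "(\<Sum>i\<in>UNIV. \<Sum>j\<in>UNIV. \<Sum>k\<in>UNIV. d i j k) \<in> casimir"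
    by (intro cv.subspace_sum subalgebra_subspace subalgebra_casimir)
  moreover have "(\<Sum>i\<in>UNIV. \<Sum>j\<in>UNIV. \<Sum>k\<in>UNIV. d i j k) = ?z - 6 *\<^sub>C tri 1 2 3"
  proof -
    have six: "6 *\<^sub>C x = x + x + x + x + x + x" for x :: "'a uea"
    proof -
      have "(6 :: complex) = 1 + 1 + 1 + 1 + 1 + 1" by simp
      then show ?thesis by (simp only: scaleC_add_left scaleC_one)
    qed
    show ?thesis
      by (simp add: d_def sum_subtractf) (simp add: sum_3 six)
  qed
  moreover have "?z \<in> A" using cubic_casimir_central A(3) by (auto simp: tri_def)
  ultimately have zc: "?z - 6 *\<^sub>C tri 1 2 3 \<in> casimir" and zA: "?z \<in> A"
    by (simp_all only:)
  have "?z - (?z - 6 *\<^sub>C tri 1 2 3) \<in> A"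
    by (rule subalgebra_diff[OF A(1) zA subsetD[OF A(2) zc]])
  then have "6 *\<^sub>C tri 1 2 3 \<in> A" by simp
  then have "(1 / 6) *\<^sub>C 6 *\<^sub>C tri 1 2 3 \<in> A" by (rule subalgebra_scaleC[OF A(1)])
  then have "tri 1 2 3 \<in> A" by (simp add: scaleC_scaleC scaleC_one)
  then have "(tri i j k - tri 1 2 3) + tri 1 2 3 \<in> A"
    using tri_congruent[OF ijk] A(2) by (intro subalgebra_add[OF A(1)]) auto
  then show ?thesis by simp
qed

lemma mon_balanced_in_casimir_centre:
  assumes A: "subalgebra A" "casimir \<subseteq> A" "centre \<subseteq> A" and "balanced w"
  shows "mon w \<in> A"
  using A(1) _ assms(4)
proof (rule mon_balanced_in_subalgebra)
  fix c :: "(3 \<times> 3) list" assume "c \<in> cycles"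
  then show "mon c \<in> A"
  proof cases
    case (loop i)
    then show ?thesis using u_diag_in_casimir A(2) by (auto simp: mon_simps)
  next
    case (digon i j)
    then show ?thesis using digon_in_casimir[of i j] A(2) by (auto simp: mon_simps)
  next
    case (triangle i j k)
    then show ?thesis using tri_in_subalgebra[OF A, of i j k] by (simp add: mon_simps tri_def mult.assoc)
  qed
qed

lemma casimir_subset_centralizer: "casimir \<subseteq> centralizer (uea_of ` torus)"
  unfolding casimir_def
proof (rule subalgebra_hull_minimal[OF _ subalgebra_centralizer], intro Un_least)
  have "u i j * u j i \<in> centralizer (uea_of ` torus)" for i j
  proof -
    have "balanced [(i, j), (j, i)]" by (simp add: balanced_def add_mset_commute)
    then have "mon [(i, j), (j, i)] \<in> cv.span (mon ` {w. balanced w})"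
      by (intro cv.span_base imageI) simp
    then show ?thesis unfolding centralizer_torus by (simp add: mon_simps)
  qed
  then show "{u i j * u j i + u j i * u i j |i j. i \<noteq> j} \<subseteq> centralizer (uea_of ` torus)"
    by (auto intro!: subalgebra_add[OF subalgebra_centralizer])
  have "uea_of s * uea_of t = uea_of t * uea_of s" if "s \<in> torus" "t \<in> torus" for s t
  proof -
    have "bracket s t = 0"
    proof (rule M_inject)
      have "M (bracket s t) $ i $ j = 0" for i j
        using torusD[OF that(2), of i j] by (cases "i = j") (simp_all add: M_bracket_torus that(1))
      then show "M (bracket s t) = M 0" by (simp add: vec_eq_iff M_zero)
    qed
    then show ?thesis using uea_of_bracket[of s t] by (simp add: uea_of_zero)
  qed
  then show "uea_of ` torus \<subseteq> centralizer (uea_of ` torus)"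
    by (auto simp: centralizer_def)
qed

theorem centralizer_generated:
  "centralizer (uea_of ` torus) = subalgebra hull (casimir \<union> centre)"
proof (rule equalityI)
  let ?A = "subalgebra hull (casimir \<union> centre)"
  have "casimir \<subseteq> ?A" "centre \<subseteq> ?A" using hull_subset[of "casimir \<union> centre" subalgebra] by auto
  then show "centralizer (uea_of ` torus) \<subseteq> ?A"
    unfolding centralizer_torus using mon_balanced_in_casimir_centre[OF subalgebra_hull]
    by (intro cv.span_minimal subalgebra_subspace subalgebra_hull) auto
  show "?A \<subseteq> centralizer (uea_of ` torus)"
  proof (rule subalgebra_hull_minimal[OF _ subalgebra_centralizer])
    show "casimir \<union> centre \<subseteq> centralizer (uea_of ` torus)"
      using casimir_subset_centralizer by (auto simp: centralizer_def)
  qed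
qed

end


section \<open>The Casimir algebra is a proper subalgebra\<close>

instantiation "fun" :: (type, complex_vector) complex_vector
begin
definition scaleC_fun :: "complex \<Rightarrow> ('a \<Rightarrow> 'b) \<Rightarrow> 'a \<Rightarrow> 'b" where
  "scaleC_fun c f = (\<lambda>x. c *\<^sub>C f x)"
instance
  by standard
    (simp_all add: scaleC_fun_def fun_eq_iff scaleC_add_right scaleC_add_left scaleC_scaleC scaleC_one)
end

text \<open>Replaces the exponent vector of a monomial by that of \<open>x\<^sub>j / x\<^sub>i\<close> times it.\<close>

definition move :: "'n \<Rightarrow> 'n \<Rightarrow> ('n \<Rightarrow> int) \<Rightarrow> 'n \<Rightarrow> int" where
  "move i j m k = m k + (if k = j then 1 else 0) - (if k = i then 1 else 0)"

lemma move_commute: "move k l (move i j m) = move i j (move k l m)"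
  by (auto simp: move_def)

lemma move_move: "move j l (move i j m) = move i l m"
  by (auto simp: move_def)

lemma move_move': "move l i (move i j m) = move l j m"
  by (auto simp: move_def)

lemma move_inverse: "move j i (move i j m) = m"
  by (auto simp: move_def)

lemma move_refl: "move i i m = m"
  by (auto simp: move_def)

text \<open>A function \<open>f\<close> on exponent vectors stands for the formal sum of the divided power monomials
  \<open>f m x\<^sup>m / m!\<close>, on which the matrix unit \<open>(i, j)\<close> acts as the differential operator
  \<open>x\<^sub>i \<partial>/\<partial>x\<^sub>j\<close>. The same formula makes sense for exponents in the integers, which avoids side
  conditions on the support.\<close>

definition divided_power_action :: "complex^'n^'n \<Rightarrow> (('n \<Rightarrow> int) \<Rightarrow> complex) \<Rightarrow> ('n \<Rightarrow> int) \<Rightarrow> complex" where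
  "divided_power_action A f m = (\<Sum>i\<in>UNIV. \<Sum>j\<in>UNIV. A $ i $ j * of_int (m i) * f (move i j m))"

lemma divided_power_action_bracket:
  fixes A B :: "complex^'n^'n"
  shows "divided_power_action (A ** B - B ** A) f =
    divided_power_action A (divided_power_action B f) - divided_power_action B (divided_power_action A f)"
proof
  fix m :: "'n \<Rightarrow> int"
  define F where "F i j k l = f (move k l (move i j m))" for i j k l
  define d :: "'n \<Rightarrow> 'n \<Rightarrow> complex" where "d a b = (if a = b then 1 else 0)" for a b
  let ?m = "\<lambda>i. complex_of_int (m i)"
  have of_int_move: "of_int (move i j m k) = ?m k + d k j - d k i" for i j k
    by (simp add: move_def d_def)
  have AB: "divided_power_action A (divided_power_action B f) m =
      (\<Sum>i\<in>UNIV. \<Sum>j\<in>UNIV. \<Sum>k\<in>UNIV. \<Sum>l\<in>UNIV.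
        A $ i $ j * B $ k $ l * (?m i * (?m k + d k j - d k i)) * F i j k l)"
    by (simp add: divided_power_action_def sum_distrib_left of_int_move F_def mult_ac)
  have BA: "divided_power_action B (divided_power_action A f) m =
      (\<Sum>i\<in>UNIV. \<Sum>j\<in>UNIV. \<Sum>k\<in>UNIV. \<Sum>l\<in>UNIV.
        A $ i $ j * B $ k $ l * (?m k * (?m i + d i l - d i k)) * F i j k l)"
  proof -
    define g where "g i j k l = A $ i $ j * B $ k $ l * (?m k * (?m i + d i l - d i k)) * F i j k l" for i j k l
    have "divided_power_action B (divided_power_action A f) m =
        (\<Sum>k\<in>UNIV. \<Sum>l\<in>UNIV. \<Sum>i\<in>UNIV. \<Sum>j\<in>UNIV. g i j k l)"
      by (simp add: divided_power_action_def sum_distrib_left of_int_move F_def g_def mult_ac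
          move_commute[of _ _ _ _ m])
    also have "\<dots> = (\<Sum>k\<in>UNIV. \<Sum>i\<in>UNIV. \<Sum>l\<in>UNIV. \<Sum>j\<in>UNIV. g i j k l)"
      by (intro sum.cong refl sum.swap)
    also have "\<dots> = (\<Sum>i\<in>UNIV. \<Sum>k\<in>UNIV. \<Sum>l\<in>UNIV. \<Sum>j\<in>UNIV. g i j k l)"
      by (rule sum.swap)
    also have "\<dots> = (\<Sum>i\<in>UNIV. \<Sum>k\<in>UNIV. \<Sum>j\<in>UNIV. \<Sum>l\<in>UNIV. g i j k l)"
      by (intro sum.cong refl sum.swap)
    also have "\<dots> = (\<Sum>i\<in>UNIV. \<Sum>j\<in>UNIV. \<Sum>k\<in>UNIV. \<Sum>l\<in>UNIV. g i j k l)"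
      by (intro sum.cong refl sum.swap)
    finally show ?thesis by (simp add: g_def)
  qed
  have "divided_power_action A (divided_power_action B f) m -
      divided_power_action B (divided_power_action A f) m =
      (\<Sum>i\<in>UNIV. \<Sum>j\<in>UNIV. \<Sum>k\<in>UNIV. \<Sum>l\<in>UNIV.
        (if k = j then A $ i $ j * B $ k $ l * ?m i * F i j k l else 0) -
        (if l = i then A $ i $ j * B $ k $ l * ?m k * F i j k l else 0))"
    unfolding AB BA sum_subtractf[symmetric]
    by (intro sum.cong refl) (auto simp: d_def algebra_simps)
  also have "\<dots> = (\<Sum>i\<in>UNIV. \<Sum>j\<in>UNIV. \<Sum>k\<in>UNIV. \<Sum>l\<in>UNIV.
        if k = j then A $ i $ j * B $ k $ l * ?m i * F i j k l else 0) -
      (\<Sum>i\<in>UNIV. \<Sum>j\<in>UNIV. \<Sum>k\<in>UNIV. \<Sum>l\<in>UNIV.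
        if l = i then A $ i $ j * B $ k $ l * ?m k * F i j k l else 0)"
    by (simp only: sum_subtractf)
  also have "(\<Sum>i\<in>UNIV. \<Sum>j\<in>UNIV. \<Sum>k\<in>UNIV. \<Sum>l\<in>UNIV.
        if k = j then A $ i $ j * B $ k $ l * ?m i * F i j k l else 0) =
      (\<Sum>i\<in>UNIV. \<Sum>j\<in>UNIV. \<Sum>l\<in>UNIV. A $ i $ j * B $ j $ l * ?m i * f (move i l m))"
  proof -
    have "(\<Sum>l\<in>UNIV. if k = j then A $ i $ j * B $ k $ l * ?m i * F i j k l else 0) =
        (if k = j then \<Sum>l\<in>UNIV. A $ i $ j * B $ k $ l * ?m i * F i j k l else 0)" for i j k
      by simp
    then show ?thesis by (simp add: F_def move_move)
  qed
  also have "\<dots> = divided_power_action (A ** B) f m"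
    unfolding divided_power_action_def
    by (rule sum.cong[OF refl], subst sum.swap)
      (simp add: matrix_matrix_mult_def sum_distrib_left sum_distrib_right)
  also have "(\<Sum>i\<in>UNIV. \<Sum>j\<in>UNIV. \<Sum>k\<in>UNIV. \<Sum>l\<in>UNIV.
        if l = i then A $ i $ j * B $ k $ l * ?m k * F i j k l else 0) =
      (\<Sum>i\<in>UNIV. \<Sum>j\<in>UNIV. \<Sum>k\<in>UNIV. B $ k $ i * A $ i $ j * ?m k * f (move k j m))"
    by (simp add: F_def move_move' mult_ac)
  also have "\<dots> = (\<Sum>i\<in>UNIV. \<Sum>k\<in>UNIV. \<Sum>j\<in>UNIV. B $ k $ i * A $ i $ j * ?m k * f (move k j m))"
    by (rule sum.cong[OF refl], rule sum.swap)
  also have "\<dots> = (\<Sum>k\<in>UNIV. \<Sum>i\<in>UNIV. \<Sum>j\<in>UNIV. B $ k $ i * A $ i $ j * ?m k * f (move k j m))"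
    by (rule sum.swap)
  also have "\<dots> = divided_power_action (B ** A) f m"
    unfolding divided_power_action_def
    by (rule sum.cong[OF refl], subst sum.swap)
      (simp add: matrix_matrix_mult_def sum_distrib_left sum_distrib_right)
  finally show "divided_power_action (A ** B - B ** A) f m =
    (divided_power_action A (divided_power_action B f) - divided_power_action B (divided_power_action A f)) m"
    by (simp add: divided_power_action_def left_diff_distrib sum_subtractf)
qed

lemma lie_module_divided_power_action:
  assumes "\<And>x y. \<phi> (x + y) = \<phi> x + \<phi> y" "\<And>c x i j. \<phi> (c *\<^sub>C x) $ i $ j = c * \<phi> x $ i $ j"
    and "\<And>x y. \<phi> (bracket x y) = \<phi> x ** \<phi> y - \<phi> y ** \<phi> x"
  shows "lie_module (\<lambda>x. divided_power_action (\<phi> x))"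
  unfolding lie_module_def
  by (intro conjI allI clinearI)
    (simp_all add: assms divided_power_action_bracket fun_eq_iff divided_power_action_def scaleC_fun_def
      scaleC_complex_def distrib_left distrib_right sum.distrib sum_distrib_left mult_ac)

lemma divided_power_action_unit:
  "divided_power_action (matrix_unit i j) f m = of_int (m i) * f (move i j m)"
proof -
  have "divided_power_action (matrix_unit i j) f m =
      (\<Sum>k\<in>UNIV. \<Sum>l\<in>UNIV. if l = j then (if k = i then of_int (m i) * f (move i j m) else 0) else 0)"
    unfolding divided_power_action_def by (intro sum.cong refl) (auto simp: matrix_unit_def)
  then show ?thesis by simp
qed

lemma divided_power_action_uminus: "divided_power_action (- A) f = - divided_power_action A f"
  by (simp add: divided_power_action_def fun_eq_iff sum_negf)

context sl3_chart
begin

text \<open>The automorphism \<open>x \<mapsto> - x\<^sup>T\<close> turns the third symmetric power of \<open>\<complex>\<^sup>3\<close>, spanned by the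
  monomials of degree three, into its dual. In both, the monomial \<open>xyz\<close> spans the zero weight space.\<close>

abbreviation sym_module :: "'a \<Rightarrow> ((3 \<Rightarrow> int) \<Rightarrow> complex) \<Rightarrow> (3 \<Rightarrow> int) \<Rightarrow> complex" where
  "sym_module x \<equiv> divided_power_action (M x)"

abbreviation dual_module :: "'a \<Rightarrow> ((3 \<Rightarrow> int) \<Rightarrow> complex) \<Rightarrow> (3 \<Rightarrow> int) \<Rightarrow> complex" where
  "dual_module x \<equiv> divided_power_action (- transpose (M x))"

lemma lie_module_sym: "lie_module sym_module"
  by (rule lie_module_divided_power_action) (simp_all add: M_add M_scale M_bracket)

lemma lie_module_dual: "lie_module dual_module"
proof (rule lie_module_divided_power_action)
  have neg: "(- A) ** (- B) = A ** (B :: complex^3^3)" for A B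
    by (simp add: vec_eq_iff matrix_matrix_mult_def)
  show "- transpose (M (bracket x y)) =
      (- transpose (M x)) ** (- transpose (M y)) - (- transpose (M y)) ** (- transpose (M x))" for x y
    unfolding neg by (simp add: M_bracket vec_eq_iff transpose_def matrix_matrix_mult_def mult.commute)
qed (simp_all add: M_add M_scale transpose_def vec_eq_iff)

definition xyz :: "(3 \<Rightarrow> int) \<Rightarrow> complex" where
  "xyz m = (if m = (\<lambda>_. 1) then 1 else 0)"

lemma sym_E: "i \<noteq> j \<Longrightarrow> sym_module (E i j) f m = of_int (m i) * f (move i j m)"
  by (simp add: M_E divided_power_action_unit)

lemma dual_E: "i \<noteq> j \<Longrightarrow> dual_module (E i j) f m = - of_int (m j) * f (move j i m)"
proof -
  assume "i \<noteq> j"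
  then have "transpose (M (E i j)) = matrix_unit j i"
    by (auto simp: M_E vec_eq_iff transpose_def matrix_unit_def)
  then show ?thesis by (simp add: divided_power_action_uminus divided_power_action_unit)
qed

lemma torus_kills_xyz:
  assumes "t \<in> torus"
  shows "sym_module t xyz = 0" "dual_module t xyz = 0"
proof -
  have diag: "divided_power_action A xyz = 0"
    if off: "\<And>i j. i \<noteq> j \<Longrightarrow> A $ i $ j = 0" and tr: "(\<Sum>i\<in>UNIV. A $ i $ i) = 0" for A
  proof
    fix m
    have "divided_power_action A xyz m =
        (\<Sum>i\<in>UNIV. \<Sum>j\<in>UNIV. if j = i then A $ i $ i * xyz m else 0)"
      unfolding divided_power_action_def
      by (intro sum.cong refl) (auto simp: off move_refl xyz_def)
    also have "\<dots> = (\<Sum>i\<in>UNIV. A $ i $ i) * xyz m" by (simp add: sum_distrib_right)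
    finally show "divided_power_action A xyz m = 0 m" by (simp add: tr)
  qed
  show "sym_module t xyz = 0" using torusD[OF assms] trace_M' by (intro diag) auto
  show "dual_module t xyz = 0"
    using torusD[OF assms] trace_M' by (intro diag) (auto simp: transpose_def sum_negf)
qed

text \<open>The twist by \<open>x \<mapsto> - x\<^sup>T\<close> fixes all \<open>\<kappa>\<close> and negates the torus, which acts by zero. So the
  generators have \<open>xyz\<close> as an eigenvector with the same eigenvalue in both modules, and this property
  defines a subalgebra.\<close>

lemma casimir_acts_equally_on_xyz:
  assumes "z \<in> casimir"
  shows "\<exists>c. uea_act sym_module z xyz = c *\<^sub>C xyz \<and> uea_act dual_module z xyz = c *\<^sub>C xyz"
proof -
  note sym = lie_module_sym and dual = lie_module_dual
  define S where "S = {z. \<exists>c. uea_act sym_module z xyz = c *\<^sub>C xyz \<and> uea_act dual_module z xyz = c *\<^sub>C xyz}"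
  have S: "z \<in> S" if "uea_act sym_module z xyz = c *\<^sub>C xyz" "uea_act dual_module z xyz = c *\<^sub>C xyz" for z c
    using that by (auto simp: S_def)
  have "subalgebra S"
    unfolding subalgebra_def
  proof (intro conjI cv.subspaceI ballI)
    show "0 \<in> S"
      by (rule S[of _ 0]) (use uea_act_scaleC[OF sym, of 0 0] uea_act_scaleC[OF dual, of 0 0] in simp_all)
    show "1 \<in> S" by (rule S[of _ 1]) (simp_all add: uea_act_one[OF sym] uea_act_one[OF dual] scaleC_one)
    fix x y assume x: "x \<in> S" and y: "y \<in> S"
    obtain c where c: "uea_act sym_module x xyz = c *\<^sub>C xyz" "uea_act dual_module x xyz = c *\<^sub>C xyz"
      using x by (auto simp: S_def)
    obtain d where d: "uea_act sym_module y xyz = d *\<^sub>C xyz" "uea_act dual_module y xyz = d *\<^sub>C xyz"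
      using y by (auto simp: S_def)
    show "x + y \<in> S"
      by (rule S[of _ "c + d"]) (simp_all add: uea_act_add[OF sym] uea_act_add[OF dual] c d scaleC_add_left)
    show "x * y \<in> S"
      by (rule S[of _ "d * c"])
        (simp_all add: uea_act_mult[OF sym] uea_act_mult[OF dual] c d scaleC_scaleC
          clinear_scaleC[OF clinear_uea_act[OF sym]] clinear_scaleC[OF clinear_uea_act[OF dual]])
  next
    fix a x assume "x \<in> S"
    then obtain c where c: "uea_act sym_module x xyz = c *\<^sub>C xyz" "uea_act dual_module x xyz = c *\<^sub>C xyz"
      by (auto simp: S_def)
    show "a *\<^sub>C x \<in> S"
      by (rule S[of _ "a * c"]) (simp_all add: uea_act_scaleC[OF sym] uea_act_scaleC[OF dual] c scaleC_scaleC)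
  qed
  moreover have "u i j * u j i + u j i * u i j \<in> S" if "i \<noteq> j" for i j
  proof (rule S[of _ 4])
    show "uea_act sym_module (u i j * u j i + u j i * u i j) xyz = 4 *\<^sub>C xyz"
      using that
      by (auto simp: uea_act_add[OF sym] uea_act_mult[OF sym] u_def uea_act_of[OF sym] fun_eq_iff sym_E
          move_inverse scaleC_fun_def scaleC_complex_def) (auto simp: xyz_def move_def)
    show "uea_act dual_module (u i j * u j i + u j i * u i j) xyz = 4 *\<^sub>C xyz"
      using that
      by (auto simp: uea_act_add[OF dual] uea_act_mult[OF dual] u_def uea_act_of[OF dual] fun_eq_iff dual_E
          move_inverse scaleC_fun_def scaleC_complex_def) (auto simp: xyz_def move_def)
  qed
  moreover have "uea_of t \<in> S" if "t \<in> torus" for t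
    by (rule S[of _ 0]) (simp_all add: uea_act_of[OF sym] uea_act_of[OF dual] torus_kills_xyz[OF that])
  ultimately have "casimir \<subseteq> S" unfolding casimir_def by (intro subalgebra_hull_minimal) auto
  then show ?thesis using assms by (auto simp: S_def)
qed

text \<open>The twist takes \<open>E 1 2 * E 2 3 * E 3 1\<close> to \<open>- E 2 1 * E 3 2 * E 1 3\<close>; the first acts on \<open>xyz\<close> by
  \<open>4\<close>, the second by \<open>-2\<close>.\<close>

lemma tri_notin_casimir: "tri 1 2 3 \<notin> casimir"
proof
  note sym = lie_module_sym and dual = lie_module_dual
  assume "tri 1 2 3 \<in> casimir"
  then obtain c where c: "uea_act sym_module (tri 1 2 3) xyz = c *\<^sub>C xyz"
      "uea_act dual_module (tri 1 2 3) xyz = c *\<^sub>C xyz"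
    using casimir_acts_equally_on_xyz by blast
  have "uea_act sym_module (tri 1 2 3) xyz (\<lambda>_. 1) = 4"
    by (simp add: tri_def uea_act_mult[OF sym] u_def uea_act_of[OF sym] sym_E move_move move_refl)
      (simp add: move_def xyz_def)
  moreover have "uea_act dual_module (tri 1 2 3) xyz (\<lambda>_. 1) = -2"
    by (simp add: tri_def uea_act_mult[OF dual] u_def uea_act_of[OF dual] dual_E move_move' move_refl)
      (simp add: move_def xyz_def)
  ultimately show False by (simp add: c scaleC_fun_def scaleC_complex_def xyz_def)
qed

end


section \<open>Simple modules and their weight spaces\<close>

context sl_chart
begin

text \<open>The words applied to \<open>v\<close> span a submodule. There are only countably many words, so simple modules
  have countable dimension.\<close>

lemma simple_module_cyclic:
  assumes "simple_lie_module \<rho>" "v \<noteq> 0"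
  shows "cv.span (range (\<lambda>w. uea_act \<rho> (mon w) v)) = UNIV"
proof -
  have \<rho>: "lie_module \<rho>" using assms(1) by (simp add: simple_lie_module_def)
  define W where "W = cv.span (range (\<lambda>w. uea_act \<rho> (mon w) v))"
  have act: "uea_act \<rho> a v \<in> W" for a
  proof -
    have "a \<in> cv.span (range mon)" by (simp add: span_mon)
    then show ?thesis
    proof (induction rule: cv.span_induct_alt)
      case base
      show ?case
        using uea_act_scaleC[OF \<rho>, of 0 0 v] by (simp add: W_def cv.span_zero)
    next
      case (step c x y)
      then have "uea_act \<rho> x v \<in> W" unfolding W_def by (auto intro: cv.span_base)
      then show ?case
        using step by (simp add: uea_act_add[OF \<rho>] uea_act_scaleC[OF \<rho>] W_def cv.span_add cv.span_scale)
    qed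
  qed
  have "\<rho> x w \<in> W" if "w \<in> W" for x w
    using that unfolding W_def
  proof (induction rule: cv.span_induct_alt)
    case base
    have "\<rho> x 0 = 0" using \<rho> clinear_scaleC[of "\<rho> x" 0 0] by (simp add: lie_module_def)
    then show ?case by (simp add: cv.span_zero)
  next
    case (step c y z)
    then obtain w where y: "y = uea_act \<rho> (mon w) v" by blast
    have "\<rho> x y = uea_act \<rho> (uea_of x * mon w) v"
      by (simp add: y uea_act_mult[OF \<rho>] uea_act_of[OF \<rho>])
    then have "\<rho> x y \<in> W" using act by simp
    moreover have "\<rho> x (c *\<^sub>C y + z) = c *\<^sub>C \<rho> x y + \<rho> x z"
      using \<rho> by (simp add: lie_module_def clinear_add clinear_scaleC)
    ultimately show ?case using step by (simp add: W_def cv.span_add cv.span_scale)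
  qed
  moreover have "cv.subspace W" by (simp add: W_def)
  moreover have "v \<in> W" using act[of 1] by (simp add: uea_act_one[OF \<rho>])
  ultimately show ?thesis
    using assms unfolding simple_lie_module_def W_def[symmetric] by blast
qed

text \<open>Kernel and image of a central element are submodules.\<close>

lemma central_element_zero_or_bijective:
  assumes \<rho>: "simple_lie_module (\<rho> :: 'a \<Rightarrow> 'v::complex_vector \<Rightarrow> 'v)" and a: "a \<in> centre"
  shows "(\<forall>v. uea_act \<rho> a v = 0) \<or> (\<forall>v. uea_act \<rho> a v = 0 \<longrightarrow> v = 0) \<and> surj (uea_act \<rho> a)"
proof -
  have lie: "lie_module \<rho>" and simple: "\<And>W. cv.subspace W \<Longrightarrow> (\<And>x w. w \<in> W \<Longrightarrow> \<rho> x w \<in> W) \<Longrightarrow> W = {0} \<or> W = UNIV"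
    using \<rho> unfolding simple_lie_module_def by blast+
  interpret T: complex_endomorphism scaleC "uea_act \<rho> a"
    using clinear_uea_act[OF lie, of a] by unfold_locales (simp_all add: clinear_add clinear_scaleC)
  have comm: "\<rho> x (uea_act \<rho> a v) = uea_act \<rho> a (\<rho> x v)" for x v
    using a by (simp add: centralizer_def flip: uea_act_of[OF lie] uea_act_mult[OF lie])
  have \<rho>0: "\<rho> x 0 = 0" for x
    using lie clinear_scaleC[of "\<rho> x" 0 0] by (simp add: lie_module_def)
  have "cv.subspace {v. uea_act \<rho> a v = 0}"
    by (rule cv.subspaceI) (simp_all add: T.T_zero T.T_add T.T_scale)
  then have ker: "{v. uea_act \<rho> a v = 0} = {0} \<or> {v. uea_act \<rho> a v = 0} = UNIV"
    by (rule simple) (simp add: \<rho>0 flip: comm)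
  have "cv.subspace (range (uea_act \<rho> a))"
  proof (rule cv.subspaceI)
    show "0 \<in> range (uea_act \<rho> a)" using T.T_zero by (metis rangeI)
    show "x + y \<in> range (uea_act \<rho> a)" if "x \<in> range (uea_act \<rho> a)" "y \<in> range (uea_act \<rho> a)" for x y
      using that by (auto simp flip: T.T_add)
    show "c *\<^sub>C x \<in> range (uea_act \<rho> a)" if "x \<in> range (uea_act \<rho> a)" for c x
      using that by (auto simp flip: T.T_scale)
  qed
  then have "range (uea_act \<rho> a) = {0} \<or> surj (uea_act \<rho> a)"
    by (rule simple) (auto simp: comm)
  then show ?thesis using ker by blast
qed

text \<open>The central element \<open>z - c\<close> is bijective if \<open>c\<close> is not an eigenvalue of \<open>z\<close>, so Dixmier's argument
  yields an eigenvalue \<open>c\<close>. Then \<open>z - c\<close> is central and not injective, hence zero.\<close>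

theorem centre_acts_by_scalars:
  assumes \<rho>: "simple_lie_module (\<rho> :: 'a \<Rightarrow> 'v::complex_vector \<Rightarrow> 'v)" and z: "z \<in> centre"
  shows "\<exists>c. \<forall>v. uea_act \<rho> z v = c *\<^sub>C v"
proof -
  have lie: "lie_module \<rho>" and nz: "(UNIV :: 'v set) \<noteq> {0}" using \<rho> by (simp_all add: simple_lie_module_def)
  then obtain v :: 'v where v: "v \<noteq> 0" by blast
  interpret T: complex_endomorphism scaleC "uea_act \<rho> z"
    using clinear_uea_act[OF lie, of z] by unfold_locales (simp_all add: clinear_add clinear_scaleC)
  have shift: "uea_act \<rho> (z + (- c) *\<^sub>C 1) v = uea_act \<rho> z v - c *\<^sub>C v" for c v
    by (simp add: uea_act_add[OF lie] uea_act_scaleC[OF lie] uea_act_one[OF lie] del: cv.scale_minus_left)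
      (simp add: cv.scale_minus_left)
  have central: "z + (- c) *\<^sub>C 1 \<in> centre" for c
    by (intro subalgebra_add[OF subalgebra_centralizer] subalgebra_scaleC[OF subalgebra_centralizer]
        subalgebra_one[OF subalgebra_centralizer] z)
  note alt = central_element_zero_or_bijective[OF \<rho> central, unfolded shift]
  have "\<exists>c. \<exists>u\<in>UNIV. u \<noteq> 0 \<and> uea_act \<rho> z u = c *\<^sub>C u"
  proof (rule T.eigenvector_exists[of UNIV "range (\<lambda>w. uea_act \<rho> (mon w) v)"])
    show "countable (range (\<lambda>w. uea_act \<rho> (mon w) v))" by simp
    show "UNIV \<subseteq> cv.span (range (\<lambda>w. uea_act \<rho> (mon w) v))"
      by (simp add: simple_module_cyclic[OF \<rho> v])
    fix c assume "\<forall>u\<in>UNIV. uea_act \<rho> z u = c *\<^sub>C u \<longrightarrow> u = 0"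
    then have "\<not> (\<forall>u. uea_act \<rho> z u - c *\<^sub>C u = 0)" using v by auto
    then have "surj (\<lambda>u. uea_act \<rho> z u - c *\<^sub>C u)" using alt[of c] unfolding shift by blast
    then show "UNIV \<subseteq> range (\<lambda>u. uea_act \<rho> z u - c *\<^sub>C u)" by blast
  qed (use nz in simp_all)
  then obtain c u where "u \<noteq> 0" "uea_act \<rho> z u - c *\<^sub>C u = 0" by auto
  then have "\<forall>v. uea_act \<rho> z v - c *\<^sub>C v = 0" using alt[of c] by blast
  then show ?thesis by (intro exI[of _ c]) simp
qed

end

context sl3_chart
begin

text \<open>A subspace \<open>W\<close> of the weight space that is stable under the Casimir algebra is stable under the centre,
  which acts by scalars, and hence under all balanced words. If \<open>v \<noteq> 0\<close> lies in \<open>W\<close>, every vector of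
  the weight space is a combination of words applied to \<open>v\<close>, and comparing the eigenvalues of \<open>h0\<close>
  leaves only the balanced ones.\<close>

theorem casimir_acts_irreducibly:
  assumes \<rho>: "simple_lie_module \<rho>" and ne: "weight_space torus \<rho> \<mu> \<noteq> {0}"
  shows "acts_irreducibly \<rho> casimir (weight_space torus \<rho> \<mu>)"
proof -
  let ?V = "weight_space torus \<rho> \<mu>"
  have lie: "lie_module \<rho>" using \<rho> by (simp add: simple_lie_module_def)
  have lin: "\<rho> x (v + w) = \<rho> x v + \<rho> x w" "\<rho> x (c *\<^sub>C v) = c *\<^sub>C \<rho> x v" for x v w c
    using lie by (simp_all add: lie_module_def clinear_add clinear_scaleC)
  have \<rho>0: "\<rho> x 0 = 0" for x using lin(2)[of x 0 0] by simp
  have V: "cv.subspace ?V"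
    by (rule cv.subspaceI) (simp_all add: weight_space_def \<rho>0 lin scaleC_add_right scaleC_scaleC mult.commute)
  have invariant: "uea_act \<rho> a v \<in> ?V" if "a \<in> casimir" "v \<in> ?V" for a v
    unfolding weight_space_def
  proof (intro CollectI ballI)
    fix t assume t: "t \<in> torus"
    then have "uea_of t * a = a * uea_of t"
      using casimir_subset_centralizer that(1) by (auto simp: centralizer_def)
    then have "\<rho> t (uea_act \<rho> a v) = uea_act \<rho> a (\<rho> t v)"
      by (simp flip: uea_act_of[OF lie] uea_act_mult[OF lie])
    also have "\<rho> t v = \<mu> t *\<^sub>C v" using that(2) t by (simp add: weight_space_def)
    finally show "\<rho> t (uea_act \<rho> a v) = \<mu> t *\<^sub>C uea_act \<rho> a v"
      by (simp add: clinear_scaleC[OF clinear_uea_act[OF lie]])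
  qed
  have "W = {0} \<or> W = ?V"
    if W: "cv.subspace W" "W \<subseteq> ?V" "\<And>a w. a \<in> casimir \<Longrightarrow> w \<in> W \<Longrightarrow> uea_act \<rho> a w \<in> W" for W
  proof (cases "W = {0}")
    case False
    then obtain v where v: "v \<in> W" "v \<noteq> 0" using cv.subspace_0[OF W(1)] by blast
    define A where "A = {a. \<forall>w\<in>W. uea_act \<rho> a w \<in> W}"
    have "subalgebra A"
      unfolding subalgebra_def A_def using W(1) uea_act_scaleC[OF lie, of 0 0]
      by (auto intro!: cv.subspaceI simp: uea_act_add[OF lie] uea_act_scaleC[OF lie] uea_act_mult[OF lie]
          uea_act_one[OF lie] cv.subspace_add cv.subspace_scale cv.subspace_0)
    moreover have "casimir \<subseteq> A" using W(3) by (auto simp: A_def)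
    moreover have "centre \<subseteq> A"
    proof
      fix z :: "'a uea" assume "z \<in> centre"
      then obtain c where "\<And>v. uea_act \<rho> z v = c *\<^sub>C v" using centre_acts_by_scalars[OF \<rho>] by blast
      then show "z \<in> A" using W(1) by (simp add: A_def cv.subspace_scale)
    qed
    ultimately have "mon w \<in> A" if "balanced w" for w
      using mon_balanced_in_casimir_centre that by blast
    then have mon_W: "uea_act \<rho> (mon w) v \<in> W" if "weight h0 w = 0" for w
      using that v(1) by (auto simp: A_def balanced_iff_weight)
    interpret T: complex_endomorphism scaleC "\<lambda>x. \<rho> h0 x - \<mu> h0 *\<^sub>C x"
      by unfold_locales (simp_all add: lin algebra_simps scaleC_scaleC mult.commute)
    have "v' \<in> W" if "v' \<in> ?V" for v'
    proof -
      have "v' \<in> cv.span ((\<lambda>w. uea_act \<rho> (mon w) v) ` {w \<in> UNIV. weight h0 w = 0})"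
      proof (rule T.kernel_on_span_of_eigenvectors)
        show "v' \<in> cv.span (range (\<lambda>w. uea_act \<rho> (mon w) v))"
          by (simp add: simple_module_cyclic[OF \<rho> v(2)])
        show "\<rho> h0 v' - \<mu> h0 *\<^sub>C v' = 0" using that h0_torus by (simp add: weight_space_def)
        fix w
        have "uea_of h0 * mon w = mon w * uea_of h0 + weight h0 w *\<^sub>C mon w"
          using torus_mon[OF h0_torus, of w] by (simp add: algebra_simps)
        then have "uea_act \<rho> (uea_of h0 * mon w) v = uea_act \<rho> (mon w * uea_of h0 + weight h0 w *\<^sub>C mon w) v"
          by simp
        then have "\<rho> h0 (uea_act \<rho> (mon w) v) = uea_act \<rho> (mon w) (\<rho> h0 v) + weight h0 w *\<^sub>C uea_act \<rho> (mon w) v"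
          by (simp add: uea_act_add[OF lie] uea_act_scaleC[OF lie] uea_act_mult[OF lie] uea_act_of[OF lie])
        moreover have "\<rho> h0 v = \<mu> h0 *\<^sub>C v" using v(1) W(2) h0_torus by (auto simp: weight_space_def)
        ultimately show "\<rho> h0 (uea_act \<rho> (mon w) v) - \<mu> h0 *\<^sub>C uea_act \<rho> (mon w) v =
            weight h0 w *\<^sub>C uea_act \<rho> (mon w) v"
          by (simp add: clinear_scaleC[OF clinear_uea_act[OF lie]])
      qed
      moreover have "cv.span ((\<lambda>w. uea_act \<rho> (mon w) v) ` {w \<in> UNIV. weight h0 w = 0}) \<subseteq> W"
        using mon_W by (intro cv.span_minimal[OF _ W(1)]) auto
      ultimately show "v' \<in> W" by (rule rev_subsetD)
    qed
    then show ?thesis using W(2) by blast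
  qed simp
  then show ?thesis
    unfolding acts_irreducibly_def using V ne invariant by blast
qed

end


section \<open>Arbitrary Cartan subalgebras and forms\<close>

context sl3_chart
begin

lemma casimir_algebra_eq:
  assumes "c \<noteq> 0" "\<And>x y. B x y = c * killing_form x y" "root_vectors B torus e f"
  shows "casimir_algebra B torus e f = casimir"
proof -
  interpret sl_form M B c using assms by unfold_locales auto
  define \<gamma> where "\<gamma> = 1 / (of_nat CARD(3) * c) / 2"
  have kappa: "kappa B torus e f (sl_root i j) = \<gamma> *\<^sub>C (u i j * u j i + u j i * u i j)" if "i \<noteq> j" for i j
    unfolding \<gamma>_def u_def by (rule kappa_root[OF assms(3) that])
  have inv: "u i j * u j i + u j i * u i j = (1 / \<gamma>) *\<^sub>C kappa B torus e f (sl_root i j)" if "i \<noteq> j" for i j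
    using assms(1) by (simp add: kappa[OF that] scaleC_scaleC scaleC_one \<gamma>_def del: cv.scale_right_distrib)
  show ?thesis
  proof
    show "casimir_algebra B torus e f \<subseteq> casimir"
      unfolding casimir_algebra_def
    proof (rule subalgebra_hull_minimal[OF _ subalgebra_casimir], intro Un_least subsetI)
      fix x assume "x \<in> kappa B torus e f ` roots torus"
      then obtain i j where "i \<noteq> j" "x = \<gamma> *\<^sub>C (u i j * u j i + u j i * u i j)"
        by (auto simp: roots_torus kappa)
      then show "x \<in> casimir"
        by (simp add: subalgebra_scaleC subalgebra_add subalgebra_casimir digon_in_casimir
            del: cv.scale_right_distrib)
    next
      show "x \<in> casimir" if "x \<in> uea_of ` torus" for x
        unfolding casimir_def using that by (intro subsetD[OF hull_subset]) blast
    qed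
    show "casimir \<subseteq> casimir_algebra B torus e f"
      unfolding casimir_def casimir_algebra_def
    proof (rule subalgebra_hull_minimal[OF _ subalgebra_hull], intro Un_least subsetI)
      let ?S = "kappa B torus e f ` roots torus \<union> uea_of ` torus"
      fix x assume "x \<in> {u i j * u j i + u j i * u i j | i j. i \<noteq> j}"
      then obtain i j where ij: "i \<noteq> j" "x = (1 / \<gamma>) *\<^sub>C kappa B torus e f (sl_root i j)" using inv by blast
      then have "kappa B torus e f (sl_root i j) \<in> ?S" using roots_torus by blast
      then show "x \<in> subalgebra hull ?S"
        unfolding ij(2) by (intro subalgebra_scaleC[OF subalgebra_hull] subsetD[OF hull_subset])
    next
      show "x \<in> subalgebra hull (kappa B torus e f ` roots torus \<union> uea_of ` torus)"
        if "x \<in> uea_of ` torus" for x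
        using that by (intro subsetD[OF hull_subset]) blast
    qed
  qed
qed

theorem casimir_psubset_centralizer: "casimir \<subset> centralizer (uea_of ` torus)"
proof -
  have "balanced [(1 :: 3, 2), (2, 3), (3, 1)]"
    by (simp add: balanced_def add_mset_commute)
  then have "mon [(1, 2), (2, 3), (3, 1)] \<in> centralizer (uea_of ` torus)"
    unfolding centralizer_torus by (intro cv.span_base imageI) simp
  then have "tri 1 2 3 \<in> centralizer (uea_of ` torus)"
    by (simp add: mon_simps tri_def mult.assoc)
  then show ?thesis using casimir_subset_centralizer tri_notin_casimir by blast
qed

end

theorem theorem1p3:
  fixes B :: "3 sl \<Rightarrow> 3 sl \<Rightarrow> complex"
    and H :: "3 sl set"
    and e f :: "(3 sl \<Rightarrow> complex) \<Rightarrow> 3 sl"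
  assumes "cartan_subalgebra H"
    and "\<exists>c. c \<noteq> 0 \<and> (\<forall>x y. B x y = c * killing_form x y)"
    and "root_vectors B H e f"
  shows "casimir_algebra B H e f \<subset> centralizer (uea_of ` H) \<and>
    centralizer (uea_of ` H) = subalgebra hull (casimir_algebra B H e f \<union> centre) \<and>
    (\<forall>(\<rho> :: 3 sl \<Rightarrow> 'v::complex_vector \<Rightarrow> 'v) \<mu>.
       simple_lie_module \<rho> \<and> \<mu> \<in> dual_space H \<and> weight_space H \<rho> \<mu> \<noteq> {0} \<longrightarrow>
         acts_irreducibly \<rho> (casimir_algebra B H e f) (weight_space H \<rho> \<mu>))"
proof -
  obtain M :: "3 sl \<Rightarrow> complex^3^3"
    where M: "sl_chart M" "H = {x. \<forall>i j. i \<noteq> j \<longrightarrow> M x $ i $ j = 0}"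
    by (rule cartan_subalgebra_chart[OF assms(1)])
  interpret sl3_chart M using M(1) by (simp add: sl3_chart_def)
  have H: "H = torus" by (simp add: M(2) torus_def)
  obtain c where "c \<noteq> 0" "\<And>x y. B x y = c * killing_form x y" using assms(2) by blast
  then have C: "casimir_algebra B H e f = casimir"
    using assms(3) unfolding H by (rule casimir_algebra_eq)
  show ?thesis
    unfolding C unfolding H
    using casimir_psubset_centralizer centralizer_generated casimir_acts_irreducibly by blast
qed

end
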